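(* Let $P\subset\mathbb{R}^n$ be an unconditional $n$-dimensional convex polytope and let $H$ be a Hanner polytope of the same dimension. Then $$|\operatorname{Flags}(P)|\ge|\operatorname{Flags}(H)|=2^n\,n!.$$
   Context: A flag of an $n$-dimensional polytope $P$ is a sequence $f=(f_0,\dots,f_n)$ of faces of $P$ with $\dim f_i=i$ and $f_i\subset f_{i+1}$ (so $f_n=P$); $\operatorname{Flags}(P)$ is the set of flags of $P$. A convex body is unconditional if it is symmetric under reflections in all coordinate hyperplanes. A Hanner polytope is any polytope that can be constructed from (origin-symmetric) line segments by taking Cartesian products and polar bodies. *)

theory Defs
  imports "HOL-Analysis.Analysis"
begin

text \<open>For a nonempty polytope of dimension \<open>n\<close> the list has the \<open>n + 1\<close> entries
  \<open>f\<^sub>0, \<dots>, f\<^sub>n\<close>. The last entry is a face of full dimension, hence \<open>P\<close> itself.\<close>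

definition flags :: "'a::euclidean_space set \<Rightarrow> 'a set list set" where
  "flags P = {f. int (length f) = aff_dim P + 1 \<and>
     (\<forall>i < length f. f ! i face_of P \<and> aff_dim (f ! i) = int i) \<and>
     (\<forall>i. Suc i < length f \<longrightarrow> f ! i \<subseteq> f ! Suc i)}"

definition coord_reflection :: "'n::finite \<Rightarrow> real ^ 'n \<Rightarrow> real ^ 'n" where
  "coord_reflection i x = (\<chi> j. if j = i then - (x $ j) else x $ j)"

definition unconditional :: "(real ^ 'n::finite) set \<Rightarrow> bool" where
  "unconditional K \<longleftrightarrow> (\<forall>i. coord_reflection i ` K = K)"

text \<open>The space with coordinates indexed by \<open>I\<close> is realised as the coordinate subspace of
  vectors supported on \<open>I\<close>, so that spaces of all dimensions up to \<open>CARD('n)\<close> live in one type.\<close>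

definition coord_subspace :: "'n::finite set \<Rightarrow> (real ^ 'n) set" where
  "coord_subspace I = {x. \<forall>j. j \<notin> I \<longrightarrow> x $ j = 0}"

text \<open>The polar body is taken relative to the coordinate subspace, not to the whole type.\<close>

definition polar_in :: "'n::finite set \<Rightarrow> (real ^ 'n) set \<Rightarrow> (real ^ 'n) set" where
  "polar_in I A = {y \<in> coord_subspace I. \<forall>x\<in>A. x \<bullet> y \<le> 1}"

text \<open>\<open>hanner_on I H\<close>: \<open>H\<close> is a Hanner polytope in the space with coordinates indexed by \<open>I\<close>.
  For sets in the coordinate subspaces of disjoint \<open>I\<close> and \<open>J\<close>, the Cartesian product is the set
  of sums \<open>x + y\<close>, since adding vectors with disjoint supports concatenates their coordinates.\<close>

inductive hanner_on :: "'n::finite set \<Rightarrow> (real ^ 'n) set \<Rightarrow> bool" where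
  segment: "0 < a \<Longrightarrow> hanner_on {i} (closed_segment (axis i (- a)) (axis i a))"
| product: "hanner_on I A \<Longrightarrow> hanner_on J B \<Longrightarrow> I \<inter> J = {} \<Longrightarrow>
    hanner_on (I \<union> J) {x + y | x y. x \<in> A \<and> y \<in> B}"
| polar: "hanner_on I A \<Longrightarrow> hanner_on I (polar_in I A)"

definition hanner_polytope :: "(real ^ 'n::finite) set \<Rightarrow> bool" where
  "hanner_polytope H \<longleftrightarrow> (\<exists>I. hanner_on I H)"

end

theory Submission
  imports Defs
begin

text \<open>Both halves are combinatorial statements about face lattices.

\<^bold>\<open>Lower bound.\<close> Let \<open>P\<close> be unconditional of dimension \<open>n\<close>. Choose a coordinate \<open>i\<close> and a sign, and let
\<open>E\<close> be the face of \<open>P\<close> on which the signed coordinate is largest. It is invariant under all the other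
reflections. Of the other \<open>n - 1\<close> coordinates, \<open>p\<close> vary on \<open>E\<close> and the remaining \<open>q\<close> vanish on it, and
\<open>dim E = p\<close>. So the interval below \<open>E\<close> in the face lattice is that of an unconditional polytope of
dimension \<open>p\<close>, and the interval from \<open>E\<close> to \<open>P\<close> behaves like that of an unconditional polytope of
dimension \<open>q\<close> (the dual of a face of the polar body). Consider only those flags of \<open>P\<close> whose vertex
lies in \<open>E\<close> and whose facet contains \<open>E\<close>. Given a flag of \<open>E\<close>, a maximal chain from \<open>E\<close> to \<open>P\<close> and one
of the \<open>p + q\<close> choose \<open>p\<close> ways to shuffle the two, there is such a flag \<open>F\<close> for which the faces
\<open>F\<^sub>j \<inter> E\<close> run through the first chain, and the joins of \<open>F\<^sub>j\<close> with \<open>E\<close> run through the second, in the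
prescribed order (\<open>shuffled_flag_exists\<close>). It is reached from the flag that passes through \<open>E\<close> by
repeatedly replacing one face by the other face between its two neighbours. Since the two chains
and the shuffle can be read off from \<open>F\<close>, induction yields at least
\<open>(p + q choose p) * 2 ^ p * p! * 2 ^ q * q! = 2 ^ (n - 1) * (n - 1)!\<close> such flags.

The \<open>2 * n\<close> choices of a coordinate and a sign lead to disjoint sets of flags
(\<open>tilted_faces_separate\<close>): if a vertex lies in two of the faces \<open>E\<close> and a facet contains both, then
that facet contains the convex hull of some \<open>E\<close> and its mirror image, which meets the interior of \<open>P\<close>.
Summation gives \<open>2 ^ n * n!\<close>. The induction runs over intervals \<open>[A, B]\<close> of a face lattice
(\<open>reflective_interval\<close>) instead of over polytopes, so that quotient polytopes and their duals never
have to be constructed.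

\<^bold>\<open>Hanner polytopes.\<close> A Hanner polytope is itself unconditional, so it only remains to bound its number
of flags from above. A segment has two flags. A face of a product is a product of faces, and
therefore a flag of a product is a shuffle of a flag of each factor, which gives at most
\<open>(p + q choose p) * 2 ^ p * p! * 2 ^ q * q! = 2 ^ (p + q) * (p + q)!\<close> flags. Passing to the polar
body reverses flags, which is an injective operation; by the bipolar theorem this yields the bound
for the polar body.\<close>

section \<open>Flags of an interval of the face lattice\<close>

text \<open>The maximal chains of faces strictly above \<open>A\<close> and up to \<open>B\<close>, listed from bottom to top and with \<open>B\<close> as
the last entry. For \<open>A = {}\<close>, whose affine dimension is \<open>- 1\<close>, these are the flags of \<open>B\<close>.\<close>
definition interval_flags :: "'a::euclidean_space set \<Rightarrow> 'a set \<Rightarrow> 'a set list set" where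
  "interval_flags A B = {f. int (length f) = aff_dim B - aff_dim A \<and>
     (\<forall>i < length f. f ! i face_of B \<and> A \<subseteq> f ! i \<and> aff_dim (f ! i) = aff_dim A + 1 + int i) \<and>
     (\<forall>i. Suc i < length f \<longrightarrow> f ! i \<subseteq> f ! Suc i)}"

lemma flags_eq_interval_flags: "flags P = interval_flags {} P"
  by (auto simp: flags_def interval_flags_def)

lemma interval_flagsD:
  assumes "f \<in> interval_flags A B"
  shows "int (length f) = aff_dim B - aff_dim A"
    and "i < length f \<Longrightarrow> f ! i face_of B"
    and "i < length f \<Longrightarrow> A \<subseteq> f ! i"
    and "i < length f \<Longrightarrow> aff_dim (f ! i) = aff_dim A + 1 + int i"
    and "Suc i < length f \<Longrightarrow> f ! i \<subseteq> f ! Suc i"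
  using assms by (auto simp: interval_flags_def)

lemma face_eqI_aff_dim:
  assumes "convex B" "X face_of B" "Y face_of B" "X \<subseteq> Y" "aff_dim Y \<le> aff_dim X"
  shows "X = Y"
proof (rule ccontr)
  assume "X \<noteq> Y"
  moreover have "X face_of Y"
    using assms face_of_imp_subset face_of_subset by metis
  moreover have "convex Y" using assms face_of_imp_convex by blast
  ultimately have "aff_dim X < aff_dim Y" using face_of_aff_dim_lt by blast
  with assms show False by simp
qed

lemma interval_flags_mono:
  assumes f: "f \<in> interval_flags A B" and ij: "i \<le> j" "j < length f"
  shows "f ! i \<subseteq> f ! j"
  using ij
proof (induction j rule: dec_induct)
  case (step n)
  then show ?case using interval_flagsD(5)[OF f, of n] by auto
qed simp

lemma interval_flags_last:
  assumes "convex B" and f: "f \<in> interval_flags A B" and "Suc i = length f"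
  shows "f ! i = B"
proof (rule face_eqI_aff_dim[OF \<open>convex B\<close>])
  show "f ! i face_of B" using interval_flagsD(2)[OF f] assms(3) by simp
  then show "f ! i \<subseteq> B" by (rule face_of_imp_subset)
  show "B face_of B" using assms(1) by (rule face_of_refl)
  have "int i = aff_dim B - aff_dim A - 1"
    using interval_flagsD(1)[OF f] assms(3) by linarith
  then show "aff_dim B \<le> aff_dim (f ! i)"
    using interval_flagsD(4)[OF f, of i] assms(3) by simp
qed

lemma finite_interval_flags:
  assumes "polytope B"
  shows "finite (interval_flags A B)"
proof (rule finite_subset)
  show "interval_flags A B \<subseteq> {f. set f \<subseteq> {F. F face_of B} \<and> length f = nat (aff_dim B - aff_dim A)}"
  proof clarify
    fix f assume f: "f \<in> interval_flags A B"
    show "set f \<subseteq> {F. F face_of B} \<and> length f = nat (aff_dim B - aff_dim A)"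
      using interval_flagsD(1,2)[OF f] by (auto simp: in_set_conv_nth)
  qed
  show "finite {f. set f \<subseteq> {F. F face_of B} \<and> length f = nat (aff_dim B - aff_dim A)}"
    using finite_polytope_faces[OF assms] by (rule finite_lists_length_eq)
qed

text \<open>The half of the diamond property of face lattices that is needed below. A nonempty proper face \<open>U\<close> of
\<open>W\<close> is the intersection of the facets of \<open>W\<close> that contain it, so for \<open>U\<close> of codimension two a single
facet \<open>Z\<close> does not suffice.\<close>
lemma exists_other_intermediate_face:
  assumes B: "polytope B" and U: "U face_of B" "U \<noteq> {}" and W: "W face_of B" and "Z face_of B"
    and UZ: "U \<subseteq> Z" and "Z \<subseteq> W"
    and dZ: "aff_dim Z = aff_dim U + 1" and dW: "aff_dim W = aff_dim U + 2"
  obtains Z' where "Z' face_of B" "U \<subseteq> Z'" "Z' \<subseteq> W" "Z' \<noteq> Z" "aff_dim Z' = aff_dim U + 1"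
proof -
  have polW: "polytope W" using B W face_of_polytope_polytope by blast
  have UW: "U face_of W"
    using assms face_of_subset[of U B W] face_of_imp_subset by blast
  have "U \<noteq> W" using dW by auto
  have UI: "U = \<Inter>{F. F facet_of W \<and> U \<subseteq> F}"
    by (rule face_of_polyhedron[OF polytope_imp_polyhedron[OF polW] UW \<open>U \<noteq> {}\<close> \<open>U \<noteq> W\<close>])
  have "\<exists>Z'. Z' facet_of W \<and> U \<subseteq> Z' \<and> Z' \<noteq> Z"
  proof (rule ccontr)
    assume "\<not> ?thesis"
    then have "{F. F facet_of W \<and> U \<subseteq> F} \<subseteq> {Z}" by blast
    then have "Z \<subseteq> \<Inter>{F. F facet_of W \<and> U \<subseteq> F}" by blast
    then have "Z = U" using UI UZ by auto
    then show False using dZ by simp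
  qed
  then obtain Z' where Z': "Z' facet_of W" "U \<subseteq> Z'" "Z' \<noteq> Z" by blast
  then have "Z' face_of W" "aff_dim Z' = aff_dim U + 1"
    using dW by (auto simp: facet_of_def)
  then show thesis
    using that[of Z'] Z' W face_of_trans face_of_imp_subset by blast
qed

section \<open>Shuffles\<close>

text \<open>A shuffle of a chain with \<open>p\<close> steps and a chain with \<open>q\<close> steps is encoded by the set \<open>T\<close> of those times
below \<open>p + q\<close> at which the first chain advances. At time \<open>j\<close> the first chain is at position \<open>steps T j\<close>
and the second at position \<open>j - steps T j\<close>.\<close>
definition steps :: "nat set \<Rightarrow> nat \<Rightarrow> nat" where
  "steps T j = card (T \<inter> {..<j})"

lemma steps_0 [simp]: "steps T 0 = 0"
  by (simp add: steps_def)

lemma steps_Suc: "steps T (Suc j) = steps T j + (if j \<in> T then 1 else 0)"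
proof -
  have "T \<inter> {..<Suc j} = (if j \<in> T then insert j (T \<inter> {..<j}) else T \<inter> {..<j})"
    by (auto simp: less_Suc_eq)
  then show ?thesis by (simp add: steps_def)
qed

lemma steps_le: "steps T j \<le> j"
  by (induction j) (auto simp: steps_Suc)

lemma steps_bounds:
  assumes "T \<subseteq> {..<p + q}" "card T = p" "j \<le> p + q"
  shows "steps T j \<le> p" "j - steps T j \<le> q" "steps T (p + q) = p"
proof -
  have fin: "finite T" using assms finite_subset by blast
  show *: "steps T (p + q) = p" using assms by (simp add: steps_def Int_absorb2)
  show "steps T j \<le> p" unfolding steps_def using assms fin
    by (metis Int_lower1 card_mono)
  have "j - steps T j \<le> k - steps T k" if "j \<le> k" for k
    using that
  proof (induction k rule: dec_induct)
    case (step n)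
    then show ?case using steps_le[of T n] by (auto simp: steps_Suc)
  qed simp
  from this[of "p + q"] show "j - steps T j \<le> q" using assms * by simp
qed

lemma nat_intermediate_value:
  fixes f :: "nat \<Rightarrow> nat"
  assumes "\<And>j. j < n \<Longrightarrow> f (Suc j) \<le> Suc (f j)" "f 0 \<le> a" "a \<le> f n"
  shows "\<exists>j\<le>n. f j = a"
  using assms
proof (induction n)
  case (Suc n)
  show ?case
  proof (cases "a \<le> f n")
    case True
    then show ?thesis using Suc by (meson le_SucI less_SucI)
  next
    case False
    then have "f (Suc n) = a" using Suc.prems by (metis Suc_leI le_antisym le_trans lessI not_le)
    then show ?thesis by blast
  qed
qed auto

lemma steps_surj:
  assumes "T \<subseteq> {..<p + q}" "card T = p"
  shows "a \<le> p \<Longrightarrow> \<exists>j\<le>p + q. steps T j = a"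
    and "b \<le> q \<Longrightarrow> \<exists>j\<le>p + q. j - steps T j = b"
proof -
  show "\<exists>j\<le>p + q. steps T j = a" if "a \<le> p"
    by (rule nat_intermediate_value) (use that steps_bounds(3)[OF assms order_refl] in \<open>auto simp: steps_Suc\<close>)
  show "\<exists>j\<le>p + q. j - steps T j = b" if "b \<le> q"
    by (rule nat_intermediate_value)
      (use that steps_bounds(3)[OF assms order_refl] in \<open>auto simp: steps_Suc\<close>)
qed

lemma steps_inj:
  assumes "T \<subseteq> {..<n}" "T' \<subseteq> {..<n}" "\<And>j. j \<le> n \<Longrightarrow> steps T j = steps T' j"
  shows "T = T'"
proof -
  have "j \<in> T \<longleftrightarrow> j \<in> T'" if "j < n" for j
  proof -
    have "steps T (Suc j) = steps T' (Suc j)" "steps T j = steps T' j"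
      using assms(3) that by auto
    then show ?thesis by (auto simp: steps_Suc split: if_splits)
  qed
  then show ?thesis using assms(1,2) by blast
qed

section \<open>Flags obtained by shuffling two chains through a face\<close>

text \<open>Fix a face \<open>E\<close> of \<open>B\<close>, a chain \<open>g\<close> of faces of \<open>E\<close> that ends at \<open>g ! p = E\<close>, and a chain of faces that
starts at \<open>E\<close>. The shuffled flags run along monotone paths through a grid of faces, where the face at
position \<open>(a, b)\<close> meets \<open>E\<close> in \<open>g ! a\<close> and has the \<open>b\<close>-th face \<open>H\<close> of the upper chain as its join with
\<open>E\<close>. The predicate describes the entries \<open>X k, \<dots>, X p\<close> of one column of this grid; its dimension \<open>d\<close> at
the bottom grows with \<open>b\<close>. The join is expressed by the inclusion \<open>X a \<subseteq> H\<close> together with minimality of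
\<open>H\<close>. The lower end \<open>k\<close> is variable because a column is built downwards from \<open>X p = H\<close>.\<close>
definition shuffle_column ::
  "'a::euclidean_space set \<Rightarrow> 'a set \<Rightarrow> 'a set list \<Rightarrow> nat \<Rightarrow> 'a set \<Rightarrow> int \<Rightarrow> (nat \<Rightarrow> 'a set) \<Rightarrow> nat \<Rightarrow> bool"
  where
  "shuffle_column B E g p H d X k \<longleftrightarrow>
     (\<forall>a. k \<le> a \<and> a \<le> p \<longrightarrow> X a face_of B \<and> aff_dim (X a) = d + int a \<and> X a \<inter> E = g ! a \<and> X a \<subseteq> H \<and>
        (\<forall>Y. Y face_of B \<and> E \<subseteq> Y \<and> X a \<subseteq> Y \<longrightarrow> H \<subseteq> Y)) \<and>
     (\<forall>a. k \<le> a \<and> a < p \<longrightarrow> X a \<subseteq> X (Suc a))"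

lemma shuffle_columnD:
  assumes "shuffle_column B E g p H d X k" "k \<le> a" "a \<le> p"
  shows "X a face_of B" "aff_dim (X a) = d + int a" "X a \<inter> E = g ! a" "X a \<subseteq> H"
    "\<And>Y. Y face_of B \<Longrightarrow> E \<subseteq> Y \<Longrightarrow> X a \<subseteq> Y \<Longrightarrow> H \<subseteq> Y"
    "a < p \<Longrightarrow> X a \<subseteq> X (Suc a)"
  using assms unfolding shuffle_column_def by blast+

text \<open>The step that fills in the grid. The faces \<open>U \<subset> Z \<subset> W\<close> sit at the positions \<open>(a, b)\<close>, \<open>(a + 1, b)\<close> and
\<open>(a + 1, b + 1)\<close>, and the other face \<open>Z'\<close> between \<open>U\<close> and \<open>W\<close> is the right one for \<open>(a, b + 1)\<close>. If \<open>Z'\<close>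
met \<open>E\<close> in more than \<open>U\<close> does, it would contain \<open>Z \<inter> E\<close>, which together with \<open>U\<close> spans \<open>Z\<close>. If the join
of \<open>Z'\<close> with \<open>E\<close> were only \<open>H\<close>, then \<open>Z'\<close> would lie in \<open>W \<inter> H\<close>, which is \<open>Z\<close>.\<close>
lemma flip_face:
  assumes B: "polytope B" and E: "E face_of B"
    and U: "U face_of B" "U \<noteq> {}" and Z: "Z face_of B" and W: "W face_of B"
    and UZ: "U \<subseteq> Z" and ZW: "Z \<subseteq> W"
    and dZ: "aff_dim Z = aff_dim U + 1" and dW: "aff_dim W = aff_dim U + 2"
    and H: "H face_of B" and H': "H' face_of B" and HH': "H \<subseteq> H'" and dH: "aff_dim H' = aff_dim H + 1"
    and ZH: "Z \<subseteq> H" and WH': "W \<subseteq> H'" and EH: "E \<subseteq> H"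
    and UE: "aff_dim (Z \<inter> E) = aff_dim (U \<inter> E) + 1" and WE: "W \<inter> E = Z \<inter> E"
    and joinU: "\<And>Y. Y face_of B \<Longrightarrow> E \<subseteq> Y \<Longrightarrow> U \<subseteq> Y \<Longrightarrow> H \<subseteq> Y"
    and joinW: "\<And>Y. Y face_of B \<Longrightarrow> E \<subseteq> Y \<Longrightarrow> W \<subseteq> Y \<Longrightarrow> H' \<subseteq> Y"
  obtains Z' where "Z' face_of B" "U \<subseteq> Z'" "Z' \<subseteq> W" "aff_dim Z' = aff_dim Z"
    "Z' \<inter> E = U \<inter> E" "\<And>Y. Y face_of B \<Longrightarrow> E \<subseteq> Y \<Longrightarrow> Z' \<subseteq> Y \<Longrightarrow> H' \<subseteq> Y"
proof -
  have cB: "convex B" using B polytope_imp_convex by blast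
  note eqI = face_eqI_aff_dim[OF cB]
  have lt: "aff_dim X < aff_dim Y" if "X face_of B" "Y face_of B" "X \<subseteq> Y" "X \<noteq> Y" for X Y
    using eqI that by (meson not_less)
  obtain Z' where Z': "Z' face_of B" "U \<subseteq> Z'" "Z' \<subseteq> W" "Z' \<noteq> Z" "aff_dim Z' = aff_dim U + 1"
    using exists_other_intermediate_face[OF B U W Z UZ ZW dZ dW] by blast
  have ne: "\<not> Z \<subseteq> Z'" using eqI[OF Z Z'(1)] Z' dZ by auto
  have cap: "Z' \<inter> E = U \<inter> E"
  proof (rule ccontr)
    assume neq: "Z' \<inter> E \<noteq> U \<inter> E"
    have "aff_dim (U \<inter> E) < aff_dim (Z' \<inter> E)"
      by (rule lt) (use neq Z' U E in \<open>auto intro: face_of_Int\<close>)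
    then have "Z' \<inter> E = Z \<inter> E"
      by (intro eqI) (use neq Z' Z E WE UE in \<open>auto intro: face_of_Int\<close>)
    then have "Z \<inter> E \<subseteq> Z' \<inter> Z" by blast
    have "aff_dim (Z' \<inter> Z) < aff_dim Z"
      by (rule lt) (use ne Z' Z in \<open>auto intro: face_of_Int\<close>)
    then have "U = Z' \<inter> Z"
      by (intro eqI) (use Z' Z U UZ dZ in \<open>auto intro: face_of_Int\<close>)
    then have "Z \<inter> E \<subseteq> U \<inter> E" using \<open>Z \<inter> E \<subseteq> Z' \<inter> Z\<close> by blast
    then have "Z \<inter> E = U \<inter> E" using UZ by blast
    then show False using UE by simp
  qed
  have joinZ': "H' \<subseteq> Y" if Y: "Y face_of B" "E \<subseteq> Y" "Z' \<subseteq> Y" for Y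
  proof (rule ccontr)
    assume "\<not> H' \<subseteq> Y"
    then have "aff_dim (Y \<inter> H') < aff_dim H'"
      by (intro lt) (use Y H' in \<open>auto intro: face_of_Int\<close>)
    moreover have "H \<subseteq> Y" using joinU Y Z' by blast
    ultimately have "H = Y \<inter> H'"
      by (intro eqI) (use Y H H' HH' dH in \<open>auto intro: face_of_Int\<close>)
    then have Z'H: "Z' \<subseteq> W \<inter> H" using Y Z' WH' by blast
    have "\<not> W \<subseteq> H"
    proof
      assume "W \<subseteq> H"
      then have "H' \<subseteq> H" using joinW H EH by blast
      then show False using dH HH' by auto
    qed
    then have "aff_dim (W \<inter> H) < aff_dim W"
      by (intro lt) (use W H in \<open>auto intro: face_of_Int\<close>)
    then have "Z = W \<inter> H"
      by (intro eqI) (use Z W H ZW ZH dZ dW in \<open>auto intro: face_of_Int\<close>)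
    then have "Z' = Z"
      by (intro eqI) (use Z' Z Z'H dZ in auto)
    then show False using Z' by blast
  qed
  show thesis using that[of Z'] Z' cap joinZ' dZ by auto
qed

text \<open>Starting from \<open>X' p = H'\<close>, the entries of the next column are found downwards, each by one flip.\<close>
lemma next_shuffle_column:
  assumes B: "polytope B" and E: "E face_of B" and d: "d \<ge> 0"
    and g: "\<And>a. a \<le> p \<Longrightarrow> aff_dim (g ! a) = d0 + int a" and gp: "g ! p = E"
    and X: "shuffle_column B E g p H d X 0" and Xp: "X p = H"
    and H: "H face_of B" and H': "H' face_of B" and HH': "H \<subseteq> H'" and dH: "aff_dim H' = aff_dim H + 1"
    and EH: "E \<subseteq> H"
  obtains X' where "shuffle_column B E g p H' (d + 1) X' 0" "X' p = H'" "\<And>a. a \<le> p \<Longrightarrow> X a \<subseteq> X' a"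
proof -
  have dimH: "aff_dim H = d + int p" using X Xp by (auto simp: shuffle_column_def)
  have "k \<le> p \<Longrightarrow> \<exists>X'. shuffle_column B E g p H' (d + 1) X' (p - k) \<and> X' p = H' \<and> (\<forall>a. p - k \<le> a \<and> a \<le> p \<longrightarrow> X a \<subseteq> X' a)" for k
  proof (induction k)
    case 0
    show ?case
    proof (intro exI conjI)
      show "shuffle_column B E g p H' (d + 1) (\<lambda>_. H') (p - 0)"
        using H' dH dimH gp EH HH' by (auto simp: shuffle_column_def)
    qed (use Xp HH' in auto)
  next
    case (Suc k)
    define a where "a = p - Suc k"
    have a: "Suc a = p - k" "a < p" "p - Suc k = a" "Suc a \<le> p" using Suc.prems by (auto simp: a_def)
    obtain X' where X': "shuffle_column B E g p H' (d + 1) X' (Suc a)" "X' p = H'"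
      "\<And>b. Suc a \<le> b \<Longrightarrow> b \<le> p \<Longrightarrow> X b \<subseteq> X' b"
      using Suc a by auto
    note Xa = shuffle_columnD[OF X le0 less_imp_le[OF a(2)]]
    note Xs = shuffle_columnD[OF X le0 a(4)]
    note Ys = shuffle_columnD[OF X'(1) order_refl a(4)]
    have ne: "X a \<noteq> {}" using Xa(2) d by auto
    obtain Z' where Z': "Z' face_of B" "X a \<subseteq> Z'" "Z' \<subseteq> X' (Suc a)" "aff_dim Z' = aff_dim (X (Suc a))"
      "Z' \<inter> E = X a \<inter> E" "\<And>Y. Y face_of B \<Longrightarrow> E \<subseteq> Y \<Longrightarrow> Z' \<subseteq> Y \<Longrightarrow> H' \<subseteq> Y"
    proof (rule flip_face[OF B E Xa(1) ne Xs(1) Ys(1) Xa(6)[OF a(2)] X'(3)[OF order_refl a(4)] _ _ H H' HH' dH Xs(4) Ys(4) EH _ _ Xa(5) Ys(5)])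
      show "aff_dim (X (Suc a) \<inter> E) = aff_dim (X a \<inter> E) + 1"
        using g a Xs(3) Xa(3) by simp
    qed (use Xa Xs Ys in auto)
    define X'' where "X'' = X'(a := Z')"
    have "shuffle_column B E g p H' (d + 1) X'' a"
      unfolding shuffle_column_def
    proof (intro conjI allI impI)
      fix b assume b: "a \<le> b \<and> b \<le> p"
      have *: "X'' b face_of B \<and> aff_dim (X'' b) = d + 1 + int b \<and> X'' b \<inter> E = g ! b \<and> X'' b \<subseteq> H' \<and>
        (\<forall>Y. Y face_of B \<and> E \<subseteq> Y \<and> X'' b \<subseteq> Y \<longrightarrow> H' \<subseteq> Y)"
      proof (cases "b = a")
        case True
        then show ?thesis using Z' Xa Xs Ys by (auto simp: X''_def)
      next
        case False
        then have "Suc a \<le> b" using b by auto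
        then show ?thesis
          using False b shuffle_columnD[OF X'(1) \<open>Suc a \<le> b\<close>] by (simp add: X''_def)
      qed
      then show "X'' b face_of B" "aff_dim (X'' b) = d + 1 + int b" "X'' b \<inter> E = g ! b" "X'' b \<subseteq> H'" by auto
      fix Y assume "Y face_of B \<and> E \<subseteq> Y \<and> X'' b \<subseteq> Y"
      then show "H' \<subseteq> Y" using * by blast
    next
      fix b assume b: "a \<le> b \<and> b < p"
      show "X'' b \<subseteq> X'' (Suc b)"
        using b Z'(3) X'(1) by (cases "b = a") (auto simp: X''_def shuffle_column_def)
    qed
    moreover have "X'' p = H'" using X'(2) a(2) by (simp add: X''_def)
    moreover have "\<forall>b. a \<le> b \<and> b \<le> p \<longrightarrow> X b \<subseteq> X'' b"
      using Z'(2) X'(3) by (auto simp: X''_def Suc_le_eq)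
    ultimately show ?case using a by auto
  qed
  from this[of p] show thesis using that by auto
qed

text \<open>Prefixing \<open>E\<close> to a chain that climbs from \<open>E\<close> to \<open>B\<close> makes its entries agree with the columns of the
grid, which are numbered from \<open>0\<close>.\<close>
lemma upper_chain:
  assumes E: "E face_of B" and "convex B" and h: "h \<in> interval_flags E B" and len: "length h = Suc q"
    and b: "b \<le> Suc q"
  shows "(E # h) ! b face_of B" "E \<subseteq> (E # h) ! b" "aff_dim ((E # h) ! b) = aff_dim E + int b"
    "b \<le> q \<Longrightarrow> (E # h) ! b \<subseteq> (E # h) ! Suc b"
proof -
  note h = interval_flagsD[OF h, unfolded len]
  show "(E # h) ! b face_of B"
    using b E h(2)[of "b - 1"] by (cases b) simp_all
  show "E \<subseteq> (E # h) ! b"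
    using b h(3)[of "b - 1"] by (cases b) simp_all
  show "aff_dim ((E # h) ! b) = aff_dim E + int b"
    using b h(4)[of "b - 1"] by (cases b) simp_all
  show "(E # h) ! b \<subseteq> (E # h) ! Suc b" if "b \<le> q"
    using that h(3)[of 0] h(5)[of "b - 1"] by (cases b) simp_all
qed

lemma shuffle_grid_exists:
  assumes B: "polytope B" and E: "E face_of B"
    and g: "g \<in> interval_flags A E" and h: "h \<in> interval_flags E B"
    and p: "length g = Suc p" and q: "length h = Suc q"
  shows "\<exists>G. (\<forall>b\<le>q. shuffle_column B E g p ((E # h) ! b) (aff_dim A + 1 + int b) (G b) 0) \<and>
    (\<forall>a\<le>p. \<forall>b<q. G b a \<subseteq> G (Suc b) a)"
proof -
  have cB: "convex B" using B polytope_imp_convex by blast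
  have cE: "convex E" using E face_of_imp_convex by blast
  have gp: "g ! p = E" using interval_flags_last[OF cE g] p by simp
  note gD = interval_flagsD[OF g, unfolded p]
  note hD = upper_chain[OF E cB h q]
  let ?H = "\<lambda>b. (E # h) ! b" and ?d = "\<lambda>b. aff_dim A + 1 + int b"
  have "k \<le> q \<Longrightarrow> \<exists>G. (\<forall>b\<le>k. shuffle_column B E g p (?H b) (?d b) (G b) 0 \<and> G b p = ?H b) \<and>
      (\<forall>a\<le>p. \<forall>b<k. G b a \<subseteq> G (Suc b) a)" for k
  proof (induction k)
    case 0
    have "shuffle_column B E g p (?H 0) (?d 0) ((!) g) 0"
      unfolding shuffle_column_def
    proof (intro conjI allI impI)
      fix a assume a: "0 \<le> a \<and> a \<le> p"
      then have *: "g ! a face_of E" "aff_dim (g ! a) = aff_dim A + 1 + int a" using gD by auto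
      then show "g ! a face_of B" using E face_of_trans by blast
      show "aff_dim (g ! a) = ?d 0 + int a" using * by simp
      have "g ! a \<subseteq> E" using * face_of_imp_subset by blast
      then show "g ! a \<inter> E = g ! a" "g ! a \<subseteq> ?H 0" by auto
    qed (use gD(5) in auto)
    then show ?case using gp by (intro exI[of _ "\<lambda>_. (!) g"]) auto
  next
    case (Suc k)
    then have "k \<le> q" by simp
    from Suc.IH[OF this] obtain G where
      "(\<forall>b\<le>k. shuffle_column B E g p (?H b) (?d b) (G b) 0 \<and> G b p = ?H b) \<and>
       (\<forall>a\<le>p. \<forall>b<k. G b a \<subseteq> G (Suc b) a)" ..
    then have G: "\<And>b. b \<le> k \<Longrightarrow> shuffle_column B E g p (?H b) (?d b) (G b) 0"
      "\<And>b. b \<le> k \<Longrightarrow> G b p = ?H b" "\<And>a b. a \<le> p \<Longrightarrow> b < k \<Longrightarrow> G b a \<subseteq> G (Suc b) a"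
      by blast+
    have k: "k \<le> Suc q" "Suc k \<le> Suc q" "k \<le> q" using Suc.prems by auto
    obtain X' where X': "shuffle_column B E g p (?H (Suc k)) (?d k + 1) X' 0" "X' p = ?H (Suc k)"
      "\<And>a. a \<le> p \<Longrightarrow> G k a \<subseteq> X' a"
    proof (rule next_shuffle_column[OF B E _ _ gp G(1)[OF order_refl] G(2)[OF order_refl]
          hD(1)[OF k(1)] hD(1)[OF k(2)] hD(4)[OF k(1) k(3)] _ hD(2)[OF k(1)]])
      show "0 \<le> ?d k" using aff_dim_geq[of A] by simp
      show "aff_dim (?H (Suc k)) = aff_dim (?H k) + 1"
        using hD(3)[OF k(1)] hD(3)[OF k(2)] by simp
      show "aff_dim (g ! a) = aff_dim A + 1 + int a" if "a \<le> p" for a using gD(4) that by simp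
    qed blast
    have "shuffle_column B E g p (?H (Suc k)) (?d (Suc k)) X' 0"
      using X'(1) by (simp add: algebra_simps)
    note col = this
    define G' where "G' = G(Suc k := X')"
    have G': "G' b = G b" if "b \<le> k" for b using that by (simp add: G'_def)
    have G'S: "G' (Suc k) = X'" by (simp add: G'_def)
    have "shuffle_column B E g p (?H b) (?d b) (G' b) 0 \<and> G' b p = ?H b" if b: "b \<le> Suc k" for b
    proof (cases "b = Suc k")
      case True
      then show ?thesis using col X'(2) G'S by blast
    next
      case False
      then have "b \<le> k" using b by simp
      then show ?thesis using G(1,2) G' by metis
    qed
    moreover have "G' b a \<subseteq> G' (Suc b) a" if "a \<le> p" "b < Suc k" for a b
    proof (cases "b = k")
      case True
      then show ?thesis using X'(3) G' G'S that(1) by simp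
    next
      case False
      then show ?thesis using G(3)[OF that(1), of b] G' that(2) by simp
    qed
    ultimately show ?case by (intro exI[of _ G']) blast
  qed
  from this[OF order_refl] obtain G where
    "(\<forall>b\<le>q. shuffle_column B E g p (?H b) (?d b) (G b) 0 \<and> G b p = ?H b) \<and>
     (\<forall>a\<le>p. \<forall>b<q. G b a \<subseteq> G (Suc b) a)" ..
  then show ?thesis by (intro exI[of _ G]) simp
qed

text \<open>Reading the grid along the path encoded by \<open>T\<close> gives a flag. The path has \<open>p + q + 1\<close> positions and ends
at the last but one face of the upper chain, in the column of index \<open>q\<close>; the top entry \<open>B\<close> is appended.\<close>
lemma shuffled_flag_exists:
  assumes B: "polytope B" and E: "E face_of B"
    and g: "g \<in> interval_flags A E" and h: "h \<in> interval_flags E B"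
    and p: "length g = Suc p" and q: "length h = Suc q"
    and T: "T \<subseteq> {..<p + q}" "card T = p"
  shows "\<exists>f \<in> interval_flags A B. \<forall>j\<le>p + q.
    f ! j \<inter> E = g ! steps T j \<and> f ! j \<subseteq> (E # h) ! (j - steps T j) \<and>
    (\<forall>Y. Y face_of B \<and> E \<subseteq> Y \<and> f ! j \<subseteq> Y \<longrightarrow> (E # h) ! (j - steps T j) \<subseteq> Y)"
proof -
  have cB: "convex B" using B polytope_imp_convex by blast
  from shuffle_grid_exists[OF B E g h p q] obtain G where
    "(\<forall>b\<le>q. shuffle_column B E g p ((E # h) ! b) (aff_dim A + 1 + int b) (G b) 0) \<and>
     (\<forall>a\<le>p. \<forall>b<q. G b a \<subseteq> G (Suc b) a)" ..
  note G = conjunct1[OF this, rule_format] conjunct2[OF this, rule_format]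
  define F where "F j = G (j - steps T j) (steps T j)" for j
  define f where "f = map F [0..<p + q + 1] @ [B]"
  have fj: "f ! j = F j" if "j \<le> p + q" for j
    using that by (simp add: f_def nth_append del: upt_Suc)
  have fl: "f ! Suc (p + q) = B" by (simp add: f_def nth_append)
  note bds = steps_bounds[OF T]
  have col: "F j face_of B" "aff_dim (F j) = aff_dim A + 1 + int j" "F j \<inter> E = g ! steps T j"
    "F j \<subseteq> (E # h) ! (j - steps T j)"
    "\<And>Y. Y face_of B \<Longrightarrow> E \<subseteq> Y \<Longrightarrow> F j \<subseteq> Y \<Longrightarrow> (E # h) ! (j - steps T j) \<subseteq> Y"
    if j: "j \<le> p + q" for j
  proof -
    note sc = shuffle_columnD[OF G(1)[OF bds(2)[OF j]] le0 bds(1)[OF j]]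
    show "F j face_of B" "F j \<inter> E = g ! steps T j" "F j \<subseteq> (E # h) ! (j - steps T j)"
      unfolding F_def by (rule sc)+
    show "aff_dim (F j) = aff_dim A + 1 + int j"
      unfolding F_def using sc(2) steps_le[of T j] by simp
    show "(E # h) ! (j - steps T j) \<subseteq> Y" if "Y face_of B" "E \<subseteq> Y" "F j \<subseteq> Y" for Y
      using that unfolding F_def by (rule sc(5))
  qed
  have Fmono: "F j \<subseteq> F (Suc j)" if "Suc j \<le> p + q" for j
  proof (cases "j \<in> T")
    case True
    have j: "j \<le> p + q" using that by simp
    have "steps T (Suc j) = Suc (steps T j)" using True by (simp add: steps_Suc)
    moreover have "steps T (Suc j) \<le> p" using bds(1)[OF that] .
    ultimately show ?thesis
      using shuffle_columnD(6)[OF G(1)[OF bds(2)[OF j]] le0 bds(1)[OF j]] by (simp add: F_def)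
  next
    case False
    then have *: "steps T (Suc j) = steps T j" by (simp add: steps_Suc)
    then have "Suc j - steps T (Suc j) = Suc (j - steps T j)" using steps_le[of T j] by simp
    then show ?thesis using G(2)[of "steps T j" "j - steps T j"] bds(1,2)[OF that] * by (simp add: F_def)
  qed
  have dims: "aff_dim B = aff_dim A + int (p + q + 2)"
    using interval_flagsD(1)[OF g] interval_flagsD(1)[OF h] p q by simp
  have len: "length f = p + q + 2" by (simp add: f_def)
  have "f \<in> interval_flags A B"
    unfolding interval_flags_def mem_Collect_eq len
  proof (intro conjI allI impI)
    show "int (p + q + 2) = aff_dim B - aff_dim A" using dims by simp
    have AE: "A \<subseteq> E" using interval_flagsD(3)[OF g, of 0] interval_flagsD(2)[OF g, of 0] p face_of_imp_subset by auto
    have AF: "A \<subseteq> F j" if "j \<le> p + q" for j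
      using interval_flagsD(3)[OF g, of "steps T j"] bds(1)[OF that] p col(3)[OF that] by auto
    fix i assume i: "i < p + q + 2"
    consider "i \<le> p + q" | "i = Suc (p + q)" using i by linarith
    note cases = this
    show "f ! i face_of B"
      by (cases rule: cases) (simp_all add: fj fl face_of_refl[OF cB] col(1))
    have "A \<subseteq> B" using AE face_of_imp_subset[OF E] by simp
    then show "A \<subseteq> f ! i"
      by (cases rule: cases) (simp_all add: fj fl AF)
    show "aff_dim (f ! i) = aff_dim A + 1 + int i"
      by (cases rule: cases) (simp_all add: fj fl col(2) dims)
  next
    fix i assume i: "Suc i < p + q + 2"
    consider "Suc i \<le> p + q" | "i = p + q" using i by linarith
    then show "f ! i \<subseteq> f ! Suc i"
    proof cases
      case 1
      then show ?thesis using Fmono[OF 1] by (simp add: fj)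
    next
      case 2
      then show ?thesis using face_of_imp_subset[OF col(1)[OF order_refl]] by (simp add: fj fl)
    qed
  qed
  show ?thesis
  proof (intro bexI[of _ f] allI impI)
    show "f \<in> interval_flags A B" by fact
    fix j assume j: "j \<le> p + q"
    show "f ! j \<inter> E = g ! steps T j \<and> f ! j \<subseteq> (E # h) ! (j - steps T j) \<and>
    (\<forall>Y. Y face_of B \<and> E \<subseteq> Y \<and> f ! j \<subseteq> Y \<longrightarrow> (E # h) ! (j - steps T j) \<subseteq> Y)"
      unfolding fj[OF j] using col(3-5)[OF j] by blast
  qed
qed

text \<open>The shuffled flag determines its ingredients. Its intersections with \<open>E\<close> are the faces
\<open>g ! steps T j\<close>, whose dimensions reveal \<open>T\<close> and which exhaust \<open>g\<close>; its joins with \<open>E\<close> exhaust \<open>h\<close>.\<close>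
lemma card_flags_through_ge:
  assumes B: "polytope B" and E: "E face_of B"
    and p: "aff_dim E = aff_dim A + 1 + int p" and q: "aff_dim B = aff_dim E + 1 + int q"
  shows "((p + q) choose p) * card (interval_flags A E) * card (interval_flags E B)
    \<le> card {f \<in> interval_flags A B. f ! 0 \<subseteq> E \<and> E \<subseteq> f ! (p + q)}"
proof -
  have cB: "convex B" using B polytope_imp_convex by blast
  have cE: "convex E" using E face_of_imp_convex by blast
  define D where "D = interval_flags A E \<times> interval_flags E B \<times> {T. T \<subseteq> {..<p + q} \<and> card T = p}"
  define R where "R t f \<longleftrightarrow> (case t of (g, h, T) \<Rightarrow> f \<in> interval_flags A B \<and>
     (\<forall>j\<le>p + q. f ! j \<inter> E = g ! steps T j \<and> f ! j \<subseteq> (E # h) ! (j - steps T j) \<and>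
       (\<forall>Y. Y face_of B \<and> E \<subseteq> Y \<and> f ! j \<subseteq> Y \<longrightarrow> (E # h) ! (j - steps T j) \<subseteq> Y)))" for t f
  have lens: "length g = Suc p" "length h = Suc q"
    if "g \<in> interval_flags A E" "h \<in> interval_flags E B" for g h
    using interval_flagsD(1)[OF that(1)] interval_flagsD(1)[OF that(2)] p q by linarith+
  have "\<exists>f. R t f" if "t \<in> D" for t
  proof -
    obtain g h T where t: "t = (g, h, T)" by (cases t)
    have gh: "g \<in> interval_flags A E" "h \<in> interval_flags E B" "T \<subseteq> {..<p + q}" "card T = p"
      using that t by (auto simp: D_def)
    show ?thesis
      using shuffled_flag_exists[OF B E gh(1,2) lens[OF gh(1,2)] gh(3,4)]
      unfolding R_def t prod.case by blast
  qed
  then obtain \<Phi> where \<Phi>: "\<And>t. t \<in> D \<Longrightarrow> R t (\<Phi> t)" by metis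
  have sub: "\<Phi> ` D \<subseteq> {f \<in> interval_flags A B. f ! 0 \<subseteq> E \<and> E \<subseteq> f ! (p + q)}"
  proof
    fix f assume "f \<in> \<Phi> ` D"
    then obtain g h T where ghT: "(g, h, T) \<in> D" and f: "f = \<Phi> (g, h, T)" by auto
    have gh: "g \<in> interval_flags A E" "h \<in> interval_flags E B" "T \<subseteq> {..<p + q}" "card T = p"
      using ghT by (auto simp: D_def)
    note len = lens[OF gh(1,2)]
    from \<Phi>[OF ghT] have fIF: "f \<in> interval_flags A B"
      and f2: "\<And>j. j \<le> p + q \<Longrightarrow> f ! j \<inter> E = g ! steps T j"
      by (auto simp: R_def f)
    have lf: "length f = p + q + 2" using interval_flagsD(1)[OF fIF] p q by linarith
    have "g ! 0 = f ! 0"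
    proof (rule face_eqI_aff_dim[OF cB])
      show "g ! 0 face_of B"
        using interval_flagsD(2)[OF gh(1), of 0] len E face_of_trans by auto
      show "f ! 0 face_of B" using interval_flagsD(2)[OF fIF] lf by simp
      show "g ! 0 \<subseteq> f ! 0" using f2[of 0] by auto
      show "aff_dim (f ! 0) \<le> aff_dim (g ! 0)"
        using interval_flagsD(4)[OF fIF, of 0] interval_flagsD(4)[OF gh(1), of 0] lf len by simp
    qed
    then have "f ! 0 \<subseteq> E" using f2[of 0] by auto
    moreover have "g ! p = E" using interval_flags_last[OF cE gh(1)] len by simp
    then have "E \<subseteq> f ! (p + q)" using f2[of "p + q"] steps_bounds(3)[OF gh(3,4) order_refl] by auto
    ultimately show "f \<in> {f \<in> interval_flags A B. f ! 0 \<subseteq> E \<and> E \<subseteq> f ! (p + q)}" using fIF by blast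
  qed
  have inj: "inj_on \<Phi> D"
  proof (rule inj_onI)
    fix t t' assume t: "t \<in> D" and t': "t' \<in> D" and eq: "\<Phi> t = \<Phi> t'"
    obtain g h T where tt: "t = (g, h, T)" by (cases t)
    obtain g' h' T' where tt': "t' = (g', h', T')" by (cases t')
    have gh: "g \<in> interval_flags A E" "h \<in> interval_flags E B" "T \<subseteq> {..<p + q}" "card T = p"
      using t tt by (auto simp: D_def)
    have gh': "g' \<in> interval_flags A E" "h' \<in> interval_flags E B" "T' \<subseteq> {..<p + q}" "card T' = p"
      using t' tt' by (auto simp: D_def)
    note len = lens[OF gh(1,2)] and len' = lens[OF gh'(1,2)]
    define f where "f = \<Phi> t"
    have f: "R (g, h, T) f" "R (g', h', T') f"
      using \<Phi>[OF t] \<Phi>[OF t'] eq by (auto simp: f_def tt tt')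
    have gg: "g ! steps T j = g' ! steps T' j" if "j \<le> p + q" for j
      using f that by (auto simp: R_def)
    have st: "steps T j = steps T' j" if "j \<le> p + q" for j
    proof -
      have "aff_dim (g ! steps T j) = aff_dim A + 1 + int (steps T j)"
        using interval_flagsD(4)[OF gh(1)] steps_bounds(1)[OF gh(3,4) that] len by simp
      moreover have "aff_dim (g' ! steps T' j) = aff_dim A + 1 + int (steps T' j)"
        using interval_flagsD(4)[OF gh'(1)] steps_bounds(1)[OF gh'(3,4) that] len' by simp
      ultimately show ?thesis using gg[OF that] by simp
    qed
    then have TT: "T = T'" by (rule steps_inj[OF gh(3) gh'(3)])
    have "g = g'"
    proof (rule nth_equalityI)
      fix i assume "i < length g"
      then have "i \<le> p" using len by simp
      then obtain j where "j \<le> p + q" "steps T j = i" using steps_surj(1)[OF gh(3,4)] by blast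
      then show "g ! i = g' ! i" using gg[of j] TT by simp
    qed (simp add: len len')
    have hh: "(E # h) ! b = (E # h') ! b" if b: "b \<le> q" for b
    proof -
      obtain j where j: "j \<le> p + q" "j - steps T j = b" using steps_surj(2)[OF gh(3,4) b] by blast
      have R1: "f ! j \<subseteq> (E # h) ! b"
        "\<And>Y. Y face_of B \<Longrightarrow> E \<subseteq> Y \<Longrightarrow> f ! j \<subseteq> Y \<Longrightarrow> (E # h) ! b \<subseteq> Y"
        using f(1) j unfolding R_def prod.case by blast+
      have R2: "f ! j \<subseteq> (E # h') ! b"
        "\<And>Y. Y face_of B \<Longrightarrow> E \<subseteq> Y \<Longrightarrow> f ! j \<subseteq> Y \<Longrightarrow> (E # h') ! b \<subseteq> Y"
        using f(2) j unfolding R_def prod.case TT by blast+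
      have bq: "b \<le> Suc q" using b by simp
      note u = upper_chain[OF E cB gh(2) len(2) bq] and u' = upper_chain[OF E cB gh'(2) len'(2) bq]
      show ?thesis using R1(2)[OF u'(1,2) R2(1)] R2(2)[OF u(1,2) R1(1)] by blast
    qed
    have "h = h'"
    proof (rule nth_equalityI)
      fix i assume "i < length h"
      then consider "Suc i \<le> q" | "i = q" using len by linarith
      then show "h ! i = h' ! i"
      proof cases
        case 1
        then show ?thesis using hh[of "Suc i"] by simp
      next
        case 2
        then show ?thesis
          using interval_flags_last[OF cB gh(2)] interval_flags_last[OF cB gh'(2)] len len' by simp
      qed
    qed (simp add: len len')
    then show "t = t'" using tt tt' TT \<open>g = g'\<close> by simp
  qed
  have "card D = card (\<Phi> ` D)" using card_image[OF inj] by simp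
  also have "\<dots> \<le> card {f \<in> interval_flags A B. f ! 0 \<subseteq> E \<and> E \<subseteq> f ! (p + q)}"
    by (rule card_mono[OF _ sub]) (simp add: finite_interval_flags[OF B])
  finally show ?thesis
    by (simp add: D_def card_cartesian_product n_subsets mult_ac)
qed

section \<open>Reflections and coordinate directions\<close>
lemma coord_reflection_nth [simp]:
  "coord_reflection i x $ j = (if j = i then - (x $ j) else x $ j)"
  by (simp add: coord_reflection_def)

lemma coord_reflection_involution [simp]: "coord_reflection i (coord_reflection i x) = x"
  by (simp add: vec_eq_iff)

lemma linear_coord_reflection: "linear (coord_reflection i)"
  by (rule linearI) (auto simp: vec_eq_iff)

lemma inj_coord_reflection: "inj (coord_reflection i)"
  by (metis coord_reflection_involution injI)

lemma mem_coord_reflection_image: "x \<in> coord_reflection i ` X \<longleftrightarrow> coord_reflection i x \<in> X"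
  by (metis coord_reflection_involution image_iff)

definition zero_coords :: "'n::finite set \<Rightarrow> real ^ 'n \<Rightarrow> real ^ 'n" where
  "zero_coords S x = (\<chi> j. if j \<in> S then 0 else x $ j)"

lemma zero_coords_nth [simp]: "zero_coords S x $ j = (if j \<in> S then 0 else x $ j)"
  by (simp add: zero_coords_def)

lemma zero_coords_insert:
  "zero_coords (insert i S) x = midpoint (zero_coords S x) (coord_reflection i (zero_coords S x))"
  by (auto simp: vec_eq_iff midpoint_def)

text \<open>Setting a coordinate to zero takes the midpoint of a point and its mirror image, so it preserves convex
sets with the corresponding symmetry. For the same reason a face that contains the projected point
contains the original one.\<close>
lemma zero_coords_mem:
  fixes B :: "(real ^ 'n::finite) set"
  assumes "convex B" and "\<And>i x. i \<in> S \<Longrightarrow> x \<in> B \<Longrightarrow> coord_reflection i x \<in> B" and "x \<in> B"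
  shows "zero_coords S x \<in> B"
proof -
  have "finite S" by simp
  then show ?thesis using assms(2)
  proof (induction S)
    case empty
    have "zero_coords {} x = x" by (simp add: vec_eq_iff)
    then show ?case using assms(3) by simp
  next
    case (insert i S)
    then show ?case unfolding zero_coords_insert
      using convexD_alt[OF assms(1), of "zero_coords S x" "coord_reflection i (zero_coords S x)" "1/2"]
      by (auto simp: midpoint_def scaleR_add_right)
  qed
qed

lemma face_zero_coords:
  fixes B :: "(real ^ 'n::finite) set"
  assumes "convex B" and C: "C face_of B" and "\<And>i x. i \<in> S \<Longrightarrow> x \<in> B \<Longrightarrow> coord_reflection i x \<in> B"
    and "x \<in> B" and "zero_coords S x \<in> C"
  shows "x \<in> C"
proof -
  have "finite S" by simp
  then show ?thesis using assms(3,5)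
  proof (induction S)
    case empty
    have "zero_coords {} x = x" by (simp add: vec_eq_iff)
    then show ?case using empty by simp
  next
    case (insert i S)
    define z where "z = zero_coords S x"
    define z' where "z' = coord_reflection i z"
    have zB: "z \<in> B" unfolding z_def
      by (rule zero_coords_mem[OF assms(1)]) (use insert assms(4) in auto)
    then have z'B: "z' \<in> B" using insert by (auto simp: z'_def)
    have m: "midpoint z z' \<in> C" using insert.prems(2) by (simp add: zero_coords_insert z_def z'_def)
    have "z \<in> C"
    proof (cases "z = z'")
      case True
      then show ?thesis using m by simp
    next
      case False
      then have "midpoint z z' \<in> open_segment z z'" by simp
      then show ?thesis using face_ofD[OF C _ zB z'B m] by blast
    qed
    then show ?case using insert by (auto simp: z_def)
  qed
qed

text \<open>A point and its mirror image with respect to coordinate \<open>i\<close> differ by a multiple of the \<open>i\<close>-th unit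
vector, which is therefore a direction of the affine hull.\<close>
lemma affine_hull_add_axis:
  fixes B :: "(real ^ 'n::finite) set"
  assumes "x \<in> B" "coord_reflection i x \<in> B" "x $ i \<noteq> 0" "z \<in> affine hull B"
  shows "z + t *\<^sub>R axis i 1 \<in> affine hull B"
proof -
  have "z + (t / (2 * x $ i)) *\<^sub>R (x - coord_reflection i x) \<in> affine hull B"
    by (rule mem_affine_3_minus) (use assms in \<open>auto intro: hull_inc\<close>)
  moreover have "(t / (2 * x $ i)) *\<^sub>R (x - coord_reflection i x) = t *\<^sub>R axis i 1"
    using assms(3) by (auto simp: vec_eq_iff axis_def)
  ultimately show ?thesis by simp
qed

text \<open>The coordinate directions in \<open>J\<close> are independent of the directions of a set \<open>M\<close> on which these
coordinates vanish.\<close>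
lemma aff_dim_add_axes:
  fixes N :: "(real ^ 'n::finite) set"
  assumes "affine N" and "M \<noteq> {}" and "M \<subseteq> N"
    and "\<And>z j. z \<in> M \<Longrightarrow> j \<in> J \<Longrightarrow> z $ j = 0"
    and "\<And>z j. z \<in> N \<Longrightarrow> j \<in> J \<Longrightarrow> z + axis j 1 \<in> N"
  shows "aff_dim M + int (card J) \<le> aff_dim N"
proof -
  have "finite J" by simp
  then show ?thesis using assms
  proof (induction J arbitrary: M)
    case empty
    then show ?case by (simp add: aff_dim_subset)
  next
    case (insert j J)
    obtain m where m: "m \<in> M" using insert by blast
    define M' where "M' = insert (m + axis j 1) M"
    have "affine hull M \<subseteq> {z. z $ j = 0}"
      by (rule hull_minimal) (use insert in \<open>auto simp: affine_def\<close>)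
    moreover have "(m + axis j 1) $ j \<noteq> 0" using insert m by (simp add: axis_def)
    ultimately have "m + axis j 1 \<notin> affine hull M" by blast
    then have d: "aff_dim M' = aff_dim M + 1" by (simp add: M'_def aff_dim_insert)
    have "aff_dim M' + int (card J) \<le> aff_dim N"
    proof (rule insert.IH)
      show "affine N" by fact
      show "M' \<noteq> {}" by (simp add: M'_def)
      show "M' \<subseteq> N" using insert.prems m by (auto simp: M'_def)
      show "z $ k = 0" if "z \<in> M'" "k \<in> J" for z k
      proof -
        have "k \<noteq> j" using that insert.hyps by blast
        then have "(m + axis j 1) $ k = 0" using insert.prems(4) m that(2) by (simp add: axis_def)
        then show ?thesis using that insert.prems(4) by (auto simp: M'_def)
      qed
      show "z + axis k 1 \<in> N" if "z \<in> N" "k \<in> J" for z k using that insert by auto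
    qed
    then show ?case using insert d by simp
  qed
qed

section \<open>Intervals with the symmetry of an unconditional polytope\<close>

text \<open>The interval \<open>[A, B]\<close> of a face lattice looks like that of an unconditional polytope of dimension
\<open>card S\<close>: \<open>B\<close> is symmetric in the coordinates in \<open>S\<close>, none of which vanishes on \<open>B\<close>, while all of them vanish
on \<open>A\<close>, and by the condition on dimensions there is no room for further directions. An unconditional
polytope \<open>P\<close> of full dimension gives the case \<open>A = {}\<close>, \<open>B = P\<close>, \<open>S = UNIV\<close>.\<close>
locale reflective_interval =
  fixes A B :: "(real ^ 'n::finite) set" and S :: "'n set"
  assumes polytope_B: "polytope B" and A_face: "A face_of B"
    and refl_B: "\<And>i x. i \<in> S \<Longrightarrow> x \<in> B \<Longrightarrow> coord_reflection i x \<in> B"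
    and A_zero: "\<And>i x. i \<in> S \<Longrightarrow> x \<in> A \<Longrightarrow> x $ i = 0"
    and B_nonzero: "\<And>i. i \<in> S \<Longrightarrow> \<exists>x\<in>B. x $ i \<noteq> 0"
    and aff_dim_B: "aff_dim B = aff_dim A + 1 + int (card S)"
begin

lemma convex_B: "convex B"
  using polytope_B polytope_imp_convex by blast

lemma A_subset: "A \<subseteq> B"
  using A_face face_of_imp_subset by blast

lemma zero_coords_A: "x \<in> A \<Longrightarrow> zero_coords S x = x"
  using A_zero by (auto simp: vec_eq_iff)

text \<open>Averaging a functional that exposes \<open>A\<close> over the reflections amounts to deleting its coordinates in
\<open>S\<close>. The result still exposes \<open>A\<close>, by \<open>face_zero_coords\<close>.\<close>
lemma symmetric_supporting_functional:
  "\<exists>u c. (\<forall>j\<in>S. u $ j = 0) \<and> (\<forall>x\<in>B. u \<bullet> x \<le> c) \<and> A = {x \<in> B. u \<bullet> x = c}"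
proof -
  have "A exposed_face_of B"
    using exposed_face_of_polyhedron polytope_imp_polyhedron polytope_B A_face by blast
  then obtain a c where a: "B \<subseteq> {x. a \<bullet> x \<le> c}" "A = B \<inter> {x. a \<bullet> x = c}"
    unfolding exposed_face_of_def by blast
  define u where "u = zero_coords S a"
  have ux: "u \<bullet> x = a \<bullet> zero_coords S x" for x
    unfolding u_def inner_vec_def by (rule sum.cong) auto
  have zB: "zero_coords S x \<in> B" if "x \<in> B" for x
    using zero_coords_mem[OF convex_B refl_B that] by blast
  show ?thesis
  proof (intro exI[of _ u] exI[of _ c] conjI ballI)
    show "u $ j = 0" if "j \<in> S" for j using that by (simp add: u_def)
    show "u \<bullet> x \<le> c" if "x \<in> B" for x using zB[OF that] a(1) ux by auto
    show "A = {x \<in> B. u \<bullet> x = c}"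
    proof (intro set_eqI iffI)
      fix x assume x: "x \<in> A"
      then show "x \<in> {x \<in> B. u \<bullet> x = c}" using a(2) zero_coords_A[OF x] ux by auto
    next
      fix x assume x: "x \<in> {x \<in> B. u \<bullet> x = c}"
      then have "zero_coords S x \<in> A" using a(2) ux zB by auto
      then show "x \<in> A" using face_zero_coords[OF convex_B A_face refl_B] x by blast
    qed
  qed
qed

text \<open>The faces called \<open>E\<close> in the introduction. Such a face arises from \<open>A\<close> by tilting a symmetric supporting
hyperplane of \<open>A\<close> in the direction of coordinate \<open>i\<close> until it meets \<open>B\<close> again. The arguments below use only
the properties listed here. The last one says that \<open>E\<close> and its mirror image with respect to coordinate \<open>i\<close>
intersect in \<open>A\<close>.\<close>
definition tilted_face :: "'n \<Rightarrow> (real ^ 'n) set \<Rightarrow> bool" where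
  "tilted_face i E \<longleftrightarrow> E face_of B \<and> A \<subseteq> E \<and>
     (\<forall>j\<in>S - {i}. \<forall>x\<in>E. coord_reflection j x \<in> E) \<and> (\<exists>v\<in>E. v $ i \<noteq> 0) \<and>
     (\<forall>x\<in>E. coord_reflection i x \<in> E \<longrightarrow> x \<in> A)"

lemma tilted_faceD:
  assumes "tilted_face i E"
  shows "E face_of B" "A \<subseteq> E" "\<And>j x. j \<in> S - {i} \<Longrightarrow> x \<in> E \<Longrightarrow> coord_reflection j x \<in> E"
    "\<exists>v\<in>E. v $ i \<noteq> 0" "\<And>x. x \<in> E \<Longrightarrow> coord_reflection i x \<in> E \<Longrightarrow> x \<in> A"
    "\<And>x. x \<in> E \<Longrightarrow> x \<in> B"
proof -
  note * = assms[unfolded tilted_face_def]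
  from * show "E face_of B" "A \<subseteq> E" "\<exists>v\<in>E. v $ i \<noteq> 0" by blast+
  then show "x \<in> B" if "x \<in> E" for x using that face_of_imp_subset by blast
  show "coord_reflection j x \<in> E" if "j \<in> S - {i}" "x \<in> E" for j x using * that by blast
  show "x \<in> A" if "x \<in> E" "coord_reflection i x \<in> E" for x using * that by blast
qed

text \<open>With \<open>u\<close> and \<open>c\<close> as in \<open>symmetric_supporting_functional\<close>, the slope \<open>\<tau>\<close> is the largest one for which
\<open>u \<bullet> x + \<tau> * x $ i \<le> c\<close> remains valid on \<open>B\<close>. Only the finitely many points \<open>v\<close> with \<open>v $ i > 0\<close> that span
\<open>B\<close> restrict it. Each of them lies outside \<open>A\<close> and hence allows a positive slope.\<close>
lemma tilted_face_exists:
  assumes i: "i \<in> S"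
  obtains E where "tilted_face i E"
proof -
  obtain u c where "\<forall>j\<in>S. u $ j = 0" "\<forall>x\<in>B. u \<bullet> x \<le> c" and uA: "A = {x \<in> B. u \<bullet> x = c}"
    using symmetric_supporting_functional by iprover
  then have u: "\<And>j. j \<in> S \<Longrightarrow> u $ j = 0" "\<And>x. x \<in> B \<Longrightarrow> u \<bullet> x \<le> c" "A = {x \<in> B. u \<bullet> x = c}"
    by blast+
  obtain V where V: "finite V" "B = convex hull V" using polytope_B unfolding polytope_def by blast
  have VB: "V \<subseteq> B" using V(2) hull_subset[of V convex] by simp
  define V' where "V' = {v \<in> V. v $ i > 0}"
  have "V' \<noteq> {}"
  proof
    assume "V' = {}"
    then have "V \<subseteq> {z. axis i 1 \<bullet> z \<le> 0}"
      by (auto simp: V'_def inner_axis' not_less)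
    then have "B \<subseteq> {z. axis i 1 \<bullet> z \<le> 0}"
      unfolding V(2) by (rule hull_minimal) (rule convex_halfspace_le)
    then have neg: "z $ i \<le> 0" if "z \<in> B" for z using that by (auto simp: inner_axis')
    obtain x where x: "x \<in> B" "x $ i \<noteq> 0" using B_nonzero[OF i] by blast
    show False using neg[OF x(1)] neg[OF refl_B[OF i x(1)]] x(2) by simp
  qed
  define \<rho> where "\<rho> v = (c - u \<bullet> v) / v $ i" for v
  define \<tau> where "\<tau> = Min (\<rho> ` V')"
  have finV': "finite V'" using V by (simp add: V'_def)
  have "\<tau> \<in> \<rho> ` V'" unfolding \<tau>_def using finV' \<open>V' \<noteq> {}\<close> by (intro Min_in) auto
  then obtain v where v: "v \<in> V'" "\<tau> = \<rho> v" by blast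
  have vB: "v \<in> B" "v $ i > 0" using v(1) VB by (auto simp: V'_def)
  then have "v \<notin> A" using A_zero[OF i] by fastforce
  then have "u \<bullet> v < c" using u(2,3) vB by fastforce
  then have \<tau>: "\<tau> > 0" using v vB by (simp add: \<rho>_def)
  define w where "w = u + \<tau> *\<^sub>R axis i 1"
  have wz: "w \<bullet> z = u \<bullet> z + \<tau> * z $ i" for z by (simp add: w_def inner_left_distrib inner_axis')
  have "V \<subseteq> {z. w \<bullet> z \<le> c}"
  proof
    fix z assume z: "z \<in> V"
    then have uz: "u \<bullet> z \<le> c" using u(2) VB by blast
    have "u \<bullet> z + \<tau> * z $ i \<le> c"
    proof (cases "z $ i > 0")
      case True
      then have "\<tau> \<le> \<rho> z" unfolding \<tau>_def using z finV' by (intro Min_le) (auto simp: V'_def)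
      then show ?thesis using True by (simp add: \<rho>_def field_simps)
    next
      case False
      then have "\<tau> * z $ i \<le> 0" using \<tau> by (simp add: mult_nonneg_nonpos)
      then show ?thesis using uz by simp
    qed
    then show "z \<in> {z. w \<bullet> z \<le> c}" by (simp add: wz)
  qed
  then have "B \<subseteq> {z. w \<bullet> z \<le> c}"
    unfolding V(2) by (rule hull_minimal) (rule convex_halfspace_le)
  then have wle: "\<And>z. z \<in> B \<Longrightarrow> w \<bullet> z \<le> c" by blast
  define E where "E = B \<inter> {z. w \<bullet> z = c}"
  have "tilted_face i E"
    unfolding tilted_face_def
  proof (intro conjI ballI impI)
    show "E face_of B" unfolding E_def
      by (rule face_of_Int_supporting_hyperplane_le[OF convex_B wle])
    show "A \<subseteq> E" using u(3) A_zero[OF i] by (auto simp: E_def wz)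
    have "u \<bullet> v + \<tau> * v $ i = c" using v(2) vB by (simp add: \<rho>_def)
    then show "\<exists>v\<in>E. v $ i \<noteq> 0" using vB by (intro bexI[of _ v]) (auto simp: E_def wz)
    have refl_u: "u \<bullet> coord_reflection j x = u \<bullet> x" if "j \<in> S" for j x
      unfolding inner_vec_def by (rule sum.cong) (use u(1)[OF that] in auto)
    show "coord_reflection j x \<in> E" if "j \<in> S - {i}" "x \<in> E" for j x
      using that refl_B refl_u by (auto simp: E_def wz)
    show "x \<in> A" if "x \<in> E" "coord_reflection i x \<in> E" for x
      using that refl_u[OF i] u(3) by (auto simp: E_def wz)
  qed
  then show thesis by (rule that)
qed

lemma tilted_face_reflect:
  assumes i: "i \<in> S" and E: "tilted_face i E"
  shows "tilted_face i (coord_reflection i ` E)"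
proof -
  note E = tilted_faceD[OF E]
  have BB: "coord_reflection i ` B = B"
    using refl_B[OF i] by (auto simp: mem_coord_reflection_image)
  have com: "coord_reflection i (coord_reflection j x) = coord_reflection j (coord_reflection i x)" for j and x :: "real ^ 'n"
    by (auto simp: vec_eq_iff)
  have Ai: "coord_reflection i x = x" if "x \<in> A" for x
    using A_zero[OF i that] by (auto simp: vec_eq_iff)
  show ?thesis
    unfolding tilted_face_def
  proof (intro conjI ballI impI)
    show "coord_reflection i ` E face_of B"
      using face_of_linear_image[OF linear_coord_reflection inj_coord_reflection, of i E B] E(1) BB by simp
    show "A \<subseteq> coord_reflection i ` E" using E(2) Ai by (auto simp: mem_coord_reflection_image)
    show "\<exists>v\<in>coord_reflection i ` E. v $ i \<noteq> 0" using E(4) by auto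
    show "coord_reflection j x \<in> coord_reflection i ` E"
      if "j \<in> S - {i}" "x \<in> coord_reflection i ` E" for j x
      using that E(3) by (simp add: mem_coord_reflection_image com)
    show "x \<in> A" if "x \<in> coord_reflection i ` E" "coord_reflection i x \<in> coord_reflection i ` E" for x
      using E(5)[of x] that by (simp add: mem_coord_reflection_image)
  qed
qed

lemma affine_hull_B_add_axis:
  assumes "j \<in> S" "z \<in> affine hull B"
  shows "z + axis j 1 \<in> affine hull B"
proof -
  obtain x where x: "x \<in> B" "x $ j \<noteq> 0" using B_nonzero[OF assms(1)] by blast
  show ?thesis using affine_hull_add_axis[OF x(1) refl_B[OF assms(1) x(1)] x(2) assms(2), of 1] by simp
qed

text \<open>Both intervals \<open>[A, E]\<close> and \<open>[E, B]\<close> have at least the dimension counted by their coordinates, plus one: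
the extra direction is the one from \<open>A\<close> to a point of \<open>E\<close>, and from \<open>E\<close> to its mirror image, respectively.
Since the two lower bounds add up to the dimension of \<open>[A, B]\<close>, they are attained.\<close>
lemma tilted_face_aff_dim:
  assumes i: "i \<in> S" and E: "tilted_face i E"
  defines "I \<equiv> {j \<in> S - {i}. \<exists>x\<in>E. x $ j \<noteq> 0}"
  defines "J \<equiv> S - {i} - I"
  shows "aff_dim E = aff_dim A + 1 + int (card I)" "aff_dim B = aff_dim E + 1 + int (card J)"
    "card S = Suc (card I + card J)"
proof -
  note E = tilted_faceD[OF E]
  have cE: "convex E" using E(1) face_of_imp_convex by blast
  obtain v where v: "v \<in> E" "v $ i \<noteq> 0" using E(4) by blast
  define v' where "v' = zero_coords (S - {i}) v"
  have v': "v' \<in> E" unfolding v'_def by (rule zero_coords_mem[OF cE E(3) v(1)])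
  have "affine hull A \<subseteq> {z. z $ i = 0}"
    by (rule hull_minimal) (use A_zero[OF i] in \<open>auto simp: affine_def\<close>)
  then have "v' \<notin> affine hull A" using v(2) by (auto simp: v'_def)
  then have d1: "aff_dim (insert v' A) = aff_dim A + 1" by (simp add: aff_dim_insert)
  have le1: "aff_dim (insert v' A) + int (card I) \<le> aff_dim (affine hull E)"
  proof (rule aff_dim_add_axes)
    show "insert v' A \<subseteq> affine hull E" using v' E(2) hull_subset[of E affine] by auto
    show "z $ j = 0" if "z \<in> insert v' A" "j \<in> I" for z j
      using that A_zero by (auto simp: v'_def I_def)
    show "z + axis j 1 \<in> affine hull E" if "z \<in> affine hull E" "j \<in> I" for z j
    proof -
      obtain x where x: "x \<in> E" "x $ j \<noteq> 0" "j \<in> S - {i}" using \<open>j \<in> I\<close> by (auto simp: I_def)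
      show ?thesis using affine_hull_add_axis[OF x(1) E(3)[OF x(3,1)] x(2) that(1), of 1] by simp
    qed
  qed auto
  define y where "y = coord_reflection i v"
  have yB: "y \<in> B" using refl_B[OF i] E(6) v by (simp add: y_def)
  have "y \<notin> E" using E(5)[OF v(1)] A_zero[OF i, of v] v(2) by (auto simp: y_def)
  moreover have "E = (affine hull E) \<inter> B" using face_of_imp_eq_affine_Int[OF convex_B E(1)] .
  ultimately have "y \<notin> affine hull E" using yB by blast
  then have d2: "aff_dim (insert y E) = aff_dim E + 1" by (simp add: aff_dim_insert)
  have le2: "aff_dim (insert y E) + int (card J) \<le> aff_dim (affine hull B)"
  proof (rule aff_dim_add_axes)
    have "insert y E \<subseteq> B" using yB E(6) by blast
    then show "insert y E \<subseteq> affine hull B" using hull_subset[of B affine] by blast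
    show "z $ j = 0" if "z \<in> insert y E" "j \<in> J" for z j
      using that v(1) by (auto simp: y_def J_def I_def)
    show "z + axis j 1 \<in> affine hull B" if "z \<in> affine hull B" "j \<in> J" for z j
      using affine_hull_B_add_axis that by (auto simp: J_def)
  qed auto
  have "card S = Suc (card (S - {i}))" using i by (metis card_Suc_Diff1 finite)
  moreover have "card (S - {i}) = card I + card J"
    unfolding J_def using card_Un_disjoint[of I "S - {i} - I"] by (simp add: I_def Un_absorb1 Collect_mono_iff Diff_partition subset_iff)
  ultimately show cS: "card S = Suc (card I + card J)" by simp
  then show "aff_dim E = aff_dim A + 1 + int (card I)" "aff_dim B = aff_dim E + 1 + int (card J)"
    using le1 le2 d1 d2 aff_dim_B by auto
qed

text \<open>A face \<open>C\<close> that contains \<open>E\<close> and its mirror image contains \<open>A\<close> and a point \<open>m\<close> outside \<open>A\<close> all of whose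
coordinates in \<open>S\<close> vanish. For reasons of dimension \<open>A\<close> and \<open>m\<close> span all points of \<open>B\<close> with vanishing
\<open>S\<close>-coordinates. So \<open>C\<close> contains these points and, by \<open>face_zero_coords\<close>, all of \<open>B\<close>.\<close>
lemma opposite_tilted_faces_join:
  assumes i: "i \<in> S" and E: "tilted_face i E" and C: "C face_of B"
    and EC: "E \<subseteq> C" "coord_reflection i ` E \<subseteq> C"
  shows "C = B"
proof -
  note E = tilted_faceD[OF E]
  have cE: "convex E" using E(1) face_of_imp_convex by blast
  have cC: "convex C" using C face_of_imp_convex by blast
  obtain v where v: "v \<in> E" "v $ i \<noteq> 0" using E(4) by blast
  define v' where "v' = zero_coords (S - {i}) v"
  define m where "m = zero_coords S v"
  have v': "v' \<in> E" unfolding v'_def by (rule zero_coords_mem[OF cE E(3) v(1)])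
  have mid: "m = midpoint v' (coord_reflection i v')"
    using zero_coords_insert[of i "S - {i}" v] i by (simp add: m_def v'_def insert_absorb)
  have "coord_reflection i v' \<in> C" "v' \<in> C" using v' EC by auto
  then have mC: "m \<in> C" unfolding mid
    using closed_segment_subset[OF _ _ cC] midpoint_in_closed_segment by blast
  have m_notA: "m \<notin> A"
  proof
    assume "m \<in> A"
    then have "v \<in> A"
      using face_zero_coords[OF convex_B A_face refl_B E(6)[OF v(1)]] by (simp add: m_def)
    then show False using A_zero[OF i] v(2) by blast
  qed
  have AC: "A \<subseteq> C" using E(2) EC by blast
  have mB: "m \<in> B" using mC C face_of_imp_subset by blast
  have "A = (affine hull A) \<inter> B" using face_of_imp_eq_affine_Int[OF convex_B A_face] .
  then have "m \<notin> affine hull A" using mB m_notA by blast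
  then have d: "aff_dim (insert m A) = aff_dim A + 1" by (simp add: aff_dim_insert)
  have "B \<subseteq> C"
  proof
    fix b assume b: "b \<in> B"
    define z where "z = zero_coords S b"
    have zB: "z \<in> B" unfolding z_def by (rule zero_coords_mem[OF convex_B refl_B b])
    have "aff_dim (insert z (insert m A)) + int (card S) \<le> aff_dim (affine hull B)"
    proof (rule aff_dim_add_axes)
      have "insert z (insert m A) \<subseteq> B" using zB mB A_subset by blast
      then show "insert z (insert m A) \<subseteq> affine hull B" using hull_subset[of B affine] by blast
      show "x $ j = 0" if "x \<in> insert z (insert m A)" "j \<in> S" for x j
        using that A_zero by (auto simp: z_def m_def)
    qed (use affine_hull_B_add_axis in auto)
    then have "z \<in> affine hull (insert m A)"
      using d aff_dim_B by (auto simp: aff_dim_insert split: if_splits)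
    also have "affine hull (insert m A) \<subseteq> affine hull C"
      using mC AC by (intro hull_mono) blast
    finally have "z \<in> (affine hull C) \<inter> B" using zB by blast
    then have "z \<in> C" using face_of_imp_eq_affine_Int[OF convex_B C] by blast
    then show "b \<in> C" using face_zero_coords[OF convex_B C refl_B b] by (simp add: z_def)
  qed
  then show "C = B" using C face_of_imp_subset by blast
qed

text \<open>No flag can have its lowest face \<open>X\<close> in two tilted faces and its highest proper face \<open>C\<close> above both. For
opposite faces, \<open>X\<close> would lie in \<open>A\<close>. For different coordinates, a point \<open>x\<close> of \<open>X\<close> outside \<open>A\<close> satisfies
\<open>x $ i \<noteq> 0\<close>, and its mirror image lies in \<open>E'\<close>, hence in \<open>C\<close>. So the \<open>i\<close>-th unit vector is a direction of
\<open>C\<close>, which thus contains the mirror image of \<open>E\<close>; this contradicts \<open>opposite_tilted_faces_join\<close>.\<close>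
lemma tilted_faces_separate:
  assumes i: "i \<in> S" and E: "tilted_face i E" and i': "i' \<in> S" and E': "tilted_face i' E'"
    and ne: "i \<noteq> i' \<or> E' = coord_reflection i ` E"
    and X: "A \<subseteq> X" "X \<noteq> A" "X \<subseteq> E" "X \<subseteq> E'"
    and C: "C face_of B" "C \<noteq> B" "E \<subseteq> C" "E' \<subseteq> C"
  shows False
proof -
  obtain x where x: "x \<in> X" "x \<notin> A" using X by blast
  then have xE: "x \<in> E" "x \<in> E'" using X by auto
  show False
  proof (cases "i = i'")
    case True
    then have "coord_reflection i x \<in> E" using ne xE(2) by (simp add: mem_coord_reflection_image)
    then show False using tilted_faceD(5)[OF E xE(1)] x(2) by blast
  next
    case False
    then have rx: "coord_reflection i x \<in> C" using tilted_faceD(3)[OF E', of i x] i xE(2) C(4) by auto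
    have xi: "x $ i \<noteq> 0"
    proof
      assume "x $ i = 0"
      then have "coord_reflection i x = x" by (auto simp: vec_eq_iff)
      then show False using tilted_faceD(5)[OF E xE(1)] xE(1) x(2) by simp
    qed
    have "coord_reflection i ` E \<subseteq> C"
    proof
      fix y assume "y \<in> coord_reflection i ` E"
      then have y: "coord_reflection i y \<in> E" by (simp add: mem_coord_reflection_image)
      then have yB: "y \<in> B" using refl_B[OF i] tilted_faceD(6)[OF E y] by fastforce
      have "coord_reflection i y + (2 * y $ i) *\<^sub>R axis i 1 \<in> affine hull C"
        by (rule affine_hull_add_axis[OF _ rx xi]) (use xE(1) C(3) y in \<open>auto intro: hull_inc\<close>)
      moreover have "coord_reflection i y + (2 * y $ i) *\<^sub>R axis i 1 = y"
        by (auto simp: vec_eq_iff axis_def)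
      ultimately show "y \<in> C" using face_of_imp_eq_affine_Int[OF convex_B C(1)] yB by auto
    qed
    then show False using opposite_tilted_faces_join[OF i E C(1,3)] C(2) by blast
  qed
qed

end

section \<open>The lower bound\<close>

text \<open>With \<open>k = card S - 1\<close>, each of the \<open>2 * card S\<close> tilted faces accounts for at least
\<open>2 ^ k * k!\<close> flags by induction, and no flag is counted twice.\<close>
theorem card_interval_flags_ge:
  assumes "reflective_interval A B S"
  shows "2 ^ card S * fact (card S) \<le> card (interval_flags A B)"
  using assms
proof (induction "card S" arbitrary: A B S rule: less_induct)
  case (less S A B)
  interpret reflective_interval A B S by fact
  have fin: "finite (interval_flags A B)" using finite_interval_flags[OF polytope_B] .
  show ?case
  proof (cases "card S")
    case 0
    then have "[B] \<in> interval_flags A B"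
      using aff_dim_B A_subset convex_B by (auto simp: interval_flags_def face_of_refl)
    then show ?thesis using 0 fin by (auto simp: Suc_le_eq card_gt_0_iff)
  next
    case (Suc k)
    have "\<forall>i. \<exists>E. i \<in> S \<longrightarrow> tilted_face i E" using tilted_face_exists by metis
    then obtain E where E: "\<And>i. i \<in> S \<Longrightarrow> tilted_face i (E i)" by metis
    \<comment> \<open>The Boolean component of \<open>t\<close> selects one of the two opposite tilted faces.\<close>
    define F where "F t = (if snd t then E (fst t) else coord_reflection (fst t) ` E (fst t))" for t
    have F: "tilted_face (fst t) (F t)" if "t \<in> S \<times> UNIV" for t
      using that E tilted_face_reflect by (auto simp: F_def)
    define \<F> where "\<F> t = {f \<in> interval_flags A B. f ! 0 \<subseteq> F t \<and> F t \<subseteq> f ! k}" for t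
    have big: "2 ^ k * fact k \<le> card (\<F> t)" if t: "t \<in> S \<times> UNIV" for t
    proof -
      define i where "i = fst t"
      have i: "i \<in> S" using t by (auto simp: i_def)
      define I where "I = {j \<in> S - {i}. \<exists>x\<in>F t. x $ j \<noteq> 0}"
      define J where "J = S - {i} - I"
      have Ft: "tilted_face i (F t)" using F[OF t] by (simp add: i_def)
      note D = tilted_faceD[OF Ft]
      note dims = tilted_face_aff_dim[OF i Ft, folded I_def, folded J_def]
      have k: "k = card I + card J" using dims(3) Suc by simp
      have "reflective_interval A (F t) I"
      proof
        show "polytope (F t)" using face_of_polytope_polytope polytope_B D(1) by blast
        show "A face_of F t"
          using face_of_subset[OF A_face D(2)] D(1) face_of_imp_subset by blast
        show "coord_reflection j x \<in> F t" if "j \<in> I" "x \<in> F t" for j x using that D(3) by (auto simp: I_def)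
        show "x $ j = 0" if "j \<in> I" "x \<in> A" for j x using that A_zero by (auto simp: I_def)
        show "\<exists>x\<in>F t. x $ j \<noteq> 0" if "j \<in> I" for j using that by (auto simp: I_def)
      qed (rule dims)
      then have 1: "2 ^ card I * fact (card I) \<le> card (interval_flags A (F t))"
        using less.hyps[of I] dims(3) by simp
      have "reflective_interval (F t) B J"
      proof
        show "x $ j = 0" if "j \<in> J" "x \<in> F t" for j x using that by (auto simp: I_def J_def)
      qed (use polytope_B D(1) refl_B B_nonzero dims in \<open>auto simp: J_def\<close>)
      then have 2: "2 ^ card J * fact (card J) \<le> card (interval_flags (F t) B)"
        using less.hyps[of J] dims(3) by simp
      have "2 ^ k * fact k = ((card I + card J) choose card I) * (2 ^ card I * fact (card I)) * (2 ^ card J * fact (card J) :: nat)"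
        using binomial_fact_lemma[of "card I" "card I + card J"] by (simp add: k power_add algebra_simps)
      also have "\<dots> \<le> ((card I + card J) choose card I) * card (interval_flags A (F t)) * card (interval_flags (F t) B)"
        using 1 2 by (intro mult_le_mono order_refl)
      also have "\<dots> \<le> card (\<F> t)"
        using card_flags_through_ge[OF polytope_B D(1) dims(1,2)] by (simp add: \<F>_def k)
      finally show ?thesis .
    qed
    have disj: "\<F> t \<inter> \<F> t' = {}" if t: "t \<in> S \<times> UNIV" "t' \<in> S \<times> UNIV" "t \<noteq> t'" for t t'
    proof (rule ccontr)
      assume "\<F> t \<inter> \<F> t' \<noteq> {}"
      then obtain f where f: "f \<in> interval_flags A B" "f ! 0 \<subseteq> F t" "f ! 0 \<subseteq> F t'" "F t \<subseteq> f ! k" "F t' \<subseteq> f ! k"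
        by (auto simp: \<F>_def)
      have len: "length f = Suc (Suc k)" using interval_flagsD(1)[OF f(1)] aff_dim_B Suc by simp
      have "f ! 0 \<noteq> A" using interval_flagsD(4)[OF f(1), of 0] len by auto
      moreover have "f ! k \<noteq> B" using interval_flagsD(4)[OF f(1), of k] len aff_dim_B Suc by auto
      moreover have "f ! k face_of B" "A \<subseteq> f ! 0"
        using interval_flagsD(2)[OF f(1), of k] interval_flagsD(3)[OF f(1), of 0] len by auto
      moreover have "fst t \<noteq> fst t' \<or> F t' = coord_reflection (fst t) ` F t"
        using t(3) by (auto simp: F_def prod_eq_iff image_image)
      ultimately show False
        using tilted_faces_separate[OF _ F[OF t(1)] _ F[OF t(2)], of "f ! 0" "f ! k"] t f by auto
    qed
    have "2 ^ card S * fact (card S) = (\<Sum>t\<in>S \<times> (UNIV :: bool set). 2 ^ k * fact k :: nat)"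
      by (simp add: card_cartesian_product Suc algebra_simps)
    also have "\<dots> \<le> (\<Sum>t\<in>S \<times> UNIV. card (\<F> t))" by (rule sum_mono) (rule big)
    also have "\<dots> = card (\<Union>t\<in>S \<times> UNIV. \<F> t)"
      by (rule card_UN_disjoint[symmetric]) (use disj fin in \<open>auto simp: \<F>_def\<close>)
    also have "\<dots> \<le> card (interval_flags A B)"
      by (rule card_mono[OF fin]) (auto simp: \<F>_def)
    finally show ?thesis .
  qed
qed

corollary card_flags_unconditional_ge:
  fixes P :: "(real ^ 'n::finite) set"
  assumes "polytope P" and "aff_dim P = int CARD('n)" and "unconditional P"
  shows "2 ^ CARD('n) * fact CARD('n) \<le> card (flags P)"
proof -
  have "reflective_interval {} P (UNIV :: 'n set)"
  proof
    show "coord_reflection i x \<in> P" if "x \<in> P" for i x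
      using that assms(3) unfolding unconditional_def by blast
    show "\<exists>x\<in>P. x $ i \<noteq> 0" for i
    proof (rule ccontr)
      assume "\<not> ?thesis"
      then have "P \<subseteq> {x. axis i 1 \<bullet> x = 0}" by (auto simp: inner_axis')
      then have "aff_dim P \<le> aff_dim {x :: real ^ 'n. axis i 1 \<bullet> x = 0}" by (rule aff_dim_subset)
      then show False using assms(2) by (simp add: aff_dim_hyperplane axis_eq_0_iff)
    qed
  qed (use assms in auto)
  then show ?thesis using card_interval_flags_ge flags_eq_interval_flags by metis
qed

section \<open>Chains of faces that exhaust the dimensions\<close>

text \<open>Dimensions of product faces and polar faces need not be computed: a strict chain of \<open>n + 1\<close> nonempty
faces of a polytope of dimension \<open>n\<close> realises each dimension exactly once.\<close>
lemma squeezed_strict_chain: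
  fixes s :: "nat \<Rightarrow> nat"
  assumes "\<And>j. j < n \<Longrightarrow> s j < s (Suc j)" and "s n \<le> n" and "j \<le> n"
  shows "s j = j"
proof -
  have le: "k \<le> s k" if "k \<le> n" for k
    using that
  proof (induction k)
    case (Suc k)
    then show ?case using assms(1)[of k] by simp
  qed simp
  have "s j + (k - j) \<le> s k" if "j \<le> k" "k \<le> n" for k
    using that
  proof (induction k rule: dec_induct)
    case (step k)
    then show ?case using assms(1)[of k] by simp
  qed simp
  from this[OF assms(3) order_refl] le[OF assms(3)] assms(2,3) show ?thesis by simp
qed

text \<open>Deleting the repetitions from a chain of faces in which the dimension rises by at most one at a time
leaves a flag.\<close>
lemma chain_compression:
  fixes A :: "'a::euclidean_space set"
  assumes cA: "convex A" and dA: "aff_dim A = int p"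
    and X: "\<And>j. j \<le> n \<Longrightarrow> X j face_of A" and mono: "\<And>i j. i \<le> j \<Longrightarrow> j \<le> n \<Longrightarrow> X i \<subseteq> X j"
    and dX: "\<And>j. j \<le> n \<Longrightarrow> aff_dim (X j) = int (a j)"
    and a: "a 0 = 0" "a n = p" "\<And>j. j < n \<Longrightarrow> a (Suc j) \<le> Suc (a j)"
  shows "\<exists>g\<in>flags A. \<forall>j\<le>n. X j = g ! a j"
proof -
  have eqX: "X i = X j" if "i \<le> n" "j \<le> n" "a i = a j" for i j
  proof -
    have "X i = X j" if "i \<le> j" "j \<le> n" "a i = a j" for i j
      by (rule face_eqI_aff_dim[OF cA]) (use that X mono dX in auto)
    then show ?thesis using that by (metis nat_le_linear)
  qed
  have "\<forall>k. \<exists>j. k \<le> p \<longrightarrow> j \<le> n \<and> a j = k"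
    using nat_intermediate_value[of n a] a by (metis le0)
  then obtain w where w: "\<And>k. k \<le> p \<Longrightarrow> w k \<le> n" "\<And>k. k \<le> p \<Longrightarrow> a (w k) = k" by metis
  define g where "g = map (X \<circ> w) [0..<Suc p]"
  have len: "length g = Suc p" by (simp add: g_def)
  have gk: "g ! k = X (w k)" if "k \<le> p" for k
    using that by (simp add: g_def del: upt_Suc)
  have "g \<in> flags A"
    unfolding flags_def mem_Collect_eq len
  proof (intro conjI allI impI)
    show "int (Suc p) = aff_dim A + 1" using dA by simp
    fix i assume "i < Suc p"
    then have i: "i \<le> p" by simp
    show "g ! i face_of A" using X[OF w(1)[OF i]] by (simp add: gk[OF i])
    show "aff_dim (g ! i) = int i" using dX[OF w(1)[OF i]] by (simp add: gk[OF i] w(2)[OF i])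
  next
    fix i assume "Suc i < Suc p"
    then have i: "i \<le> p" "Suc i \<le> p" by auto
    have "w i \<le> w (Suc i)"
    proof (rule ccontr)
      assume "\<not> w i \<le> w (Suc i)"
      then have "X (w (Suc i)) \<subseteq> X (w i)" using mono w(1)[OF i(1)] by simp
      then have "aff_dim (X (w (Suc i))) \<le> aff_dim (X (w i))" by (rule aff_dim_subset)
      then show False using dX w i by simp
    qed
    then show "g ! i \<subseteq> g ! Suc i" using mono w(1)[OF i(2)] by (simp add: gk i)
  qed
  moreover have "X j = g ! a j" if j: "j \<le> n" for j
  proof -
    have "X j \<subseteq> A" using X[OF j] face_of_imp_subset by blast
    then have "aff_dim (X j) \<le> aff_dim A" by (rule aff_dim_subset)
    then have ap: "a j \<le> p" using dX[OF j] dA by simp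
    show ?thesis using eqX[OF j w(1)[OF ap]] w(2)[OF ap] gk[OF ap] by simp
  qed
  ultimately show ?thesis by blast
qed

section \<open>Polytopes that are neighbourhoods of the origin in a coordinate subspace\<close>
definition solid_in :: "'n::finite set \<Rightarrow> (real ^ 'n) set \<Rightarrow> bool" where
  "solid_in I K \<longleftrightarrow> polytope K \<and> K \<subseteq> coord_subspace I \<and>
     (\<exists>r>0. \<forall>x\<in>coord_subspace I. norm x \<le> r \<longrightarrow> x \<in> K)"

lemma aff_dim_nonneg: "X \<noteq> {} \<Longrightarrow> 0 \<le> aff_dim X"
  using aff_dim_negative_iff[of X] by linarith

lemma subspace_coord_subspace: "subspace (coord_subspace I)"
  by (auto simp: coord_subspace_def subspace_def)

lemma zero_coords_in_coord_subspace: "zero_coords (- I) x \<in> coord_subspace I"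
  by (auto simp: coord_subspace_def)

lemma zero_coords_coord_subspace: "x \<in> coord_subspace I \<Longrightarrow> zero_coords (- I) x = x"
  by (auto simp: coord_subspace_def vec_eq_iff)

lemma zero_coords_coord_subspace_disjoint:
  "x \<in> coord_subspace J \<Longrightarrow> I \<inter> J = {} \<Longrightarrow> zero_coords (- I) x = 0"
  by (auto simp: coord_subspace_def vec_eq_iff)

lemma zero_coords_add: "zero_coords S (x + y) = zero_coords S x + zero_coords S y"
  by (auto simp: vec_eq_iff)

lemma inner_zero_coords: "x \<in> coord_subspace I \<Longrightarrow> x \<bullet> zero_coords (- I) a = x \<bullet> a"
  unfolding inner_vec_def by (rule sum.cong) (auto simp: coord_subspace_def)

lemma norm_zero_coords_le: "norm (zero_coords S x) \<le> norm x"
  by (rule norm_le_componentwise_cart) simp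

lemma aff_dim_coord_subspace: "aff_dim (coord_subspace I) = int (card I)"
proof -
  have "aff_dim {0 :: real ^ 'a} + int (card I) \<le> aff_dim (coord_subspace I)"
    by (rule aff_dim_add_axes)
      (auto simp: subspace_imp_affine[OF subspace_coord_subspace], auto simp: coord_subspace_def axis_def)
  moreover have "aff_dim (coord_subspace I) + int (card (- I)) \<le> aff_dim (UNIV :: (real ^ 'a) set)"
  proof (rule aff_dim_add_axes)
    show "coord_subspace I \<noteq> {}" using subspace_0[OF subspace_coord_subspace] by blast
  qed (auto simp: coord_subspace_def)
  moreover have "card I + card (- I) = CARD('a)"
    using card_Un_disjoint[of I "- I"] by simp
  ultimately show ?thesis by simp
qed

lemma solid_inD:
  assumes "solid_in I K"
  shows "polytope K" "K \<subseteq> coord_subspace I" "convex K" "0 \<in> K" "aff_dim K = int (card I)"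
proof -
  from assms obtain r where r: "r > 0" "\<And>x. x \<in> coord_subspace I \<Longrightarrow> norm x \<le> r \<Longrightarrow> x \<in> K"
    and K: "polytope K" "K \<subseteq> coord_subspace I"
    unfolding solid_in_def by blast
  show "polytope K" "K \<subseteq> coord_subspace I" by fact+
  show "convex K" using K polytope_imp_convex by blast
  have "0 \<in> coord_subspace I" by (simp add: coord_subspace_def)
  then show 0: "0 \<in> K" using r by simp
  have "aff_dim {0 :: real ^ 'a} + int (card I) \<le> aff_dim (affine hull K)"
  proof (rule aff_dim_add_axes)
    show "{0} \<subseteq> affine hull K" using 0 by (simp add: hull_inc)
    fix z j assume z: "z \<in> affine hull K" and j: "j \<in> I"
    have "r *\<^sub>R axis j 1 \<in> coord_subspace I" using j by (auto simp: coord_subspace_def axis_def)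
    moreover have "norm (r *\<^sub>R axis j 1 :: real ^ 'a) \<le> r" using r(1) by simp
    ultimately have "r *\<^sub>R axis j 1 \<in> affine hull K" by (intro hull_inc r(2))
    then have "z + (1 / r) *\<^sub>R (r *\<^sub>R axis j 1 - 0) \<in> affine hull K"
      using z 0 by (intro mem_affine_3_minus) (auto intro: hull_inc)
    then show "z + axis j 1 \<in> affine hull K" using r(1) by simp
  qed auto
  moreover have "aff_dim K \<le> aff_dim (coord_subspace I)" using K(2) by (rule aff_dim_subset)
  ultimately show "aff_dim K = int (card I)" by (simp add: aff_dim_coord_subspace)
qed

lemma solid_in_absorbs:
  assumes "solid_in I K" "z \<in> coord_subspace I"
  obtains t where "t > 0" "t *\<^sub>R z \<in> K" "- (t *\<^sub>R z) \<in> K"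
proof -
  obtain r where r: "r > 0" "\<And>x. x \<in> coord_subspace I \<Longrightarrow> norm x \<le> r \<Longrightarrow> x \<in> K"
    using assms(1) unfolding solid_in_def by blast
  define t where "t = r / (norm z + 1)"
  have p: "norm z + 1 > 0" using norm_ge_zero[of z] by linarith
  have t: "t > 0" using r(1) p by (simp add: t_def)
  have "norm z * r \<le> r * (norm z + 1)" using r(1) by (simp add: algebra_simps)
  then have "norm (t *\<^sub>R z) \<le> r" using t p by (simp add: t_def field_simps)
  moreover have "t *\<^sub>R z \<in> coord_subspace I" "- (t *\<^sub>R z) \<in> coord_subspace I"
    using assms(2) by (auto simp: coord_subspace_def)
  ultimately show thesis using that[OF t] r(2) by simp
qed

section \<open>Flags of products\<close>

definition coord_sum :: "(real ^ 'n) set \<Rightarrow> (real ^ 'n) set \<Rightarrow> (real ^ 'n) set" where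
  "coord_sum A B = {x + y | x y. x \<in> A \<and> y \<in> B}"

lemma coord_sum_unique:
  assumes "x \<in> coord_subspace I" "x' \<in> coord_subspace I" "y \<in> coord_subspace J" "y' \<in> coord_subspace J"
    and "I \<inter> J = {}" and "x + y = x' + y'"
  shows "x = x'" "y = y'"
proof -
  have "zero_coords (- I) (x + y) = zero_coords (- I) (x' + y')" using assms(6) by simp
  then show "x = x'"
    using assms(1,2) zero_coords_coord_subspace_disjoint[OF assms(3,5)]
      zero_coords_coord_subspace_disjoint[OF assms(4,5)]
    by (simp add: zero_coords_add zero_coords_coord_subspace)
  then show "y = y'" using assms(6) by simp
qed

lemma solid_in_coord_sum:
  assumes A: "solid_in I A" and B: "solid_in J B" and IJ: "I \<inter> J = {}"
  shows "solid_in (I \<union> J) (coord_sum A B)"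
proof -
  obtain r where r: "r > 0" "\<And>x. x \<in> coord_subspace I \<Longrightarrow> norm x \<le> r \<Longrightarrow> x \<in> A"
    using A unfolding solid_in_def by blast
  obtain r' where r': "r' > 0" "\<And>x. x \<in> coord_subspace J \<Longrightarrow> norm x \<le> r' \<Longrightarrow> x \<in> B"
    using B unfolding solid_in_def by blast
  have "coord_sum A B = (\<lambda>z. fst z + snd z) ` (A \<times> B)"
    by (force simp: coord_sum_def)
  moreover have "linear (\<lambda>z :: (real ^ 'a) \<times> (real ^ 'a). fst z + snd z)"
    by (rule linearI) (auto simp: algebra_simps)
  ultimately have "polytope (coord_sum A B)"
    using polytope_linear_image[OF _ polytope_Times[OF solid_inD(1)[OF A] solid_inD(1)[OF B]]] by metis
  moreover have "coord_sum A B \<subseteq> coord_subspace (I \<union> J)"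
    using solid_inD(2)[OF A] solid_inD(2)[OF B] unfolding coord_sum_def coord_subspace_def by force
  moreover have "x \<in> coord_sum A B" if x: "x \<in> coord_subspace (I \<union> J)" "norm x \<le> min r r'" for x
  proof -
    have "x = zero_coords (- I) x + zero_coords (- J) x"
      using x(1) IJ by (auto simp: vec_eq_iff coord_subspace_def)
    moreover have "zero_coords (- I) x \<in> A"
      using r(2)[OF zero_coords_in_coord_subspace] norm_zero_coords_le[of "- I" x] x(2) by simp
    moreover have "zero_coords (- J) x \<in> B"
      using r'(2)[OF zero_coords_in_coord_subspace] norm_zero_coords_le[of "- J" x] x(2) by simp
    ultimately show ?thesis unfolding coord_sum_def by blast
  qed
  ultimately show ?thesis
    unfolding solid_in_def using r(1) r'(1) by (intro conjI exI[of _ "min r r'"]) auto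
qed

text \<open>The projection of \<open>F \<subseteq> coord_sum A B\<close> to the factor \<open>A\<close>. As \<open>coord_sum\<close> is commutative, \<open>summand_face B A F\<close> is
the projection to the other factor.\<close>
definition summand_face :: "(real ^ 'n) set \<Rightarrow> (real ^ 'n) set \<Rightarrow> (real ^ 'n) set \<Rightarrow> (real ^ 'n) set" where
  "summand_face A B F = {x \<in> A. \<exists>y\<in>B. x + y \<in> F}"

lemma coord_sum_commute: "coord_sum A B = coord_sum B A"
  unfolding coord_sum_def by (rule Collect_cong) (metis add.commute)

text \<open>The points \<open>x + y'\<close> and \<open>x' + y\<close> have the same midpoint as \<open>x + y\<close> and \<open>x' + y'\<close>. This is why a face of a
product is the product of its projections.\<close>
lemma face_of_coord_sum_exchange:
  assumes A: "A \<subseteq> coord_subspace I" and B: "B \<subseteq> coord_subspace J" and IJ: "I \<inter> J = {}"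
    and F: "F face_of coord_sum A B"
    and 1: "x \<in> A" "y \<in> B" "x + y \<in> F" and 2: "x' \<in> A" "y' \<in> B" "x' + y' \<in> F"
  shows "x + y' \<in> F"
proof (cases "x + y' = x' + y")
  case True
  then have "x = x'" using coord_sum_unique(1)[of x I x' y' J y] A B IJ 1 2 by blast
  then show ?thesis using 2 by simp
next
  case False
  have K: "x + y' \<in> coord_sum A B" "x' + y \<in> coord_sum A B"
    using 1 2 unfolding coord_sum_def by blast+
  have "midpoint (x + y') (x' + y) = midpoint (x + y) (x' + y')"
    by (simp add: midpoint_def algebra_simps)
  also have "\<dots> \<in> F"
    using closed_segment_subset[OF 1(3) 2(3) face_of_imp_convex[OF F]] midpoint_in_closed_segment by blast
  finally have m: "midpoint (x + y') (x' + y) \<in> F" .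
  have "midpoint (x + y') (x' + y) \<in> open_segment (x + y') (x' + y)" using False by simp
  then show ?thesis using face_ofD[OF F _ K m] by blast
qed

lemma summand_face_face_of:
  assumes A: "A \<subseteq> coord_subspace I" "convex A" and B: "B \<subseteq> coord_subspace J" and IJ: "I \<inter> J = {}"
    and F: "F face_of coord_sum A B"
  shows "summand_face A B F face_of A"
proof (cases "summand_face A B F = {}")
  case False
  then obtain x0 y where y: "x0 \<in> A" "y \<in> B" "x0 + y \<in> F" by (auto simp: summand_face_def)
  have eq: "summand_face A B F = {x \<in> A. x + y \<in> F}"
    using face_of_coord_sum_exchange[OF A(1) B IJ F _ _ _ y] y(2) by (auto simp: summand_face_def)
  show ?thesis
    unfolding face_of_def eq
  proof (intro conjI ballI impI)
    have "{x \<in> A. x + y \<in> F} = A \<inter> (\<lambda>x. - y + x) ` F"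
      by (auto simp: image_iff algebra_simps)
    then show "convex {x \<in> A. x + y \<in> F}"
      using A(2) face_of_imp_convex[OF F] by (simp add: convex_Int)
    fix a b x assume ab: "a \<in> A" "b \<in> A" "x \<in> {x \<in> A. x + y \<in> F}" "x \<in> open_segment a b"
    then have "y + x \<in> open_segment (y + a) (y + b)"
      using open_segment_translation_eq[of y x a b] by simp
    moreover have "y + a \<in> coord_sum A B" "y + b \<in> coord_sum A B" "y + x \<in> F"
      using ab y(2) by (auto simp: coord_sum_def add.commute)
    ultimately have "y + a \<in> F \<and> y + b \<in> F" using face_ofD[OF F] by blast
    then show "a \<in> {x \<in> A. x + y \<in> F}" "b \<in> {x \<in> A. x + y \<in> F}" using ab by (auto simp: add.commute)
  qed auto
qed simp

lemma face_of_coord_sum_eq: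
  assumes A: "A \<subseteq> coord_subspace I" and B: "B \<subseteq> coord_subspace J" and IJ: "I \<inter> J = {}"
    and F: "F face_of coord_sum A B"
  shows "F = coord_sum (summand_face A B F) (summand_face B A F)"
proof
  have "F \<subseteq> coord_sum A B" using F face_of_imp_subset by blast
  then show "F \<subseteq> coord_sum (summand_face A B F) (summand_face B A F)"
    unfolding coord_sum_def summand_face_def by (force simp: add.commute)
  show "coord_sum (summand_face A B F) (summand_face B A F) \<subseteq> F"
  proof
    fix z assume "z \<in> coord_sum (summand_face A B F) (summand_face B A F)"
    then obtain x y where z: "z = x + y" "x \<in> summand_face A B F" "y \<in> summand_face B A F"
      unfolding coord_sum_def by blast
    then obtain x' y' where "x \<in> A" "y' \<in> B" "x + y' \<in> F" "x' \<in> A" "y \<in> B" "x' + y \<in> F"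
      unfolding summand_face_def by (auto simp: add.commute)
    then show "z \<in> F" using face_of_coord_sum_exchange[OF A B IJ F] z(1) by blast
  qed
qed

text \<open>Writing the faces of a flag as products \<open>X j\<close> times \<open>Y j\<close>, the sum of the dimensions of \<open>X j\<close> and \<open>Y j\<close>
is strictly increasing in \<open>j\<close> and thus equal to \<open>j\<close>. So exactly one of them grows at each step, and the
flag is a shuffle of a flag of \<open>A\<close> and a flag of \<open>B\<close>.\<close>
lemma card_flags_coord_sum_le:
  fixes A B :: "(real ^ 'n::finite) set"
  assumes A: "solid_in I A" and B: "solid_in J B" and IJ: "I \<inter> J = {}"
  shows "card (flags (coord_sum A B)) \<le>
    ((card I + card J) choose card I) * (card (flags A) * card (flags B))"
proof -
  define p where "p = card I"
  define q where "q = card J"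
  note A' = solid_inD[OF A] and B' = solid_inD[OF B]
  have K: "solid_in (I \<union> J) (coord_sum A B)" using solid_in_coord_sum[OF A B IJ] .
  have dK: "aff_dim (coord_sum A B) = int (p + q)"
    using solid_inD(5)[OF K] card_Un_disjoint[of I J] IJ by (simp add: p_def q_def)
  have cK: "convex (coord_sum A B)" using solid_inD(3)[OF K] .
  define W where "W = flags A \<times> flags B \<times> {T. T \<subseteq> {..<p + q} \<and> card T = p}"
  define dec where "dec = (\<lambda>(g :: (real ^ 'n) set list, h, T). map (\<lambda>j. coord_sum (g ! steps T j) (h ! (j - steps T j))) [0..<Suc (p + q)])"
  have "flags (coord_sum A B) \<subseteq> dec ` W"
  proof
    fix f assume f: "f \<in> flags (coord_sum A B)"
    then have fi: "f \<in> interval_flags {} (coord_sum A B)" by (simp add: flags_eq_interval_flags)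
    have len: "length f = Suc (p + q)" using interval_flagsD(1)[OF fi] dK by simp
    have face: "f ! j face_of coord_sum A B" "aff_dim (f ! j) = int j" if "j \<le> p + q" for j
      using interval_flagsD(2,4)[OF fi, of j] that len by auto
    have fmono: "f ! i \<subseteq> f ! j" if "i \<le> j" "j \<le> p + q" for i j
      using interval_flags_mono[OF fi that(1)] that(2) len by simp
    define X where "X j = summand_face A B (f ! j)" for j
    define Y where "Y j = summand_face B A (f ! j)" for j
    have X: "X j face_of A" and Y: "Y j face_of B" and fXY: "f ! j = coord_sum (X j) (Y j)" if "j \<le> p + q" for j
      using summand_face_face_of[OF A'(2,3) B'(2) IJ face(1)[OF that]]
        summand_face_face_of[OF B'(2,3) A'(2), of "f ! j"] face(1)[OF that] IJ
        face_of_coord_sum_eq[OF A'(2) B'(2) IJ face(1)[OF that]]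
      by (simp_all add: X_def Y_def coord_sum_commute Int_commute)
    have Xmono: "X i \<subseteq> X j" and Ymono: "Y i \<subseteq> Y j" if "i \<le> j" "j \<le> p + q" for i j
      using fmono[OF that] by (auto simp: X_def Y_def summand_face_def)
    have ne: "X j \<noteq> {}" "Y j \<noteq> {}" if "j \<le> p + q" for j
    proof -
      have "f ! j \<noteq> {}" using face(2)[OF that] by auto
      then show "X j \<noteq> {}" "Y j \<noteq> {}" using fXY[OF that] by (auto simp: coord_sum_def)
    qed
    define a where "a j = nat (aff_dim (X j))" for j
    define b where "b j = nat (aff_dim (Y j))" for j
    have da: "aff_dim (X j) = int (a j)" and db: "aff_dim (Y j) = int (b j)" if "j \<le> p + q" for j
      using ne[OF that] by (simp_all add: a_def b_def aff_dim_nonneg)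
    have ap: "a j \<le> p" and bq: "b j \<le> q" if "j \<le> p + q" for j
      using aff_dim_subset[OF face_of_imp_subset[OF X[OF that]]] aff_dim_subset[OF face_of_imp_subset[OF Y[OF that]]]
        da[OF that] db[OF that] A'(5) B'(5) by (simp_all add: p_def q_def)
    have amono: "a i \<le> a j" and bmono: "b i \<le> b j" if "i \<le> j" "j \<le> p + q" for i j
      using aff_dim_subset[OF Xmono[OF that]] aff_dim_subset[OF Ymono[OF that]] da db that by auto
    have strict: "a j + b j < a (Suc j) + b (Suc j)" if j: "j < p + q" for j
    proof (rule ccontr)
      assume "\<not> ?thesis"
      then have "a (Suc j) = a j" "b (Suc j) = b j" using amono[of j "Suc j"] bmono[of j "Suc j"] j by auto
      then have "X j = X (Suc j)" "Y j = Y (Suc j)"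
        using face_eqI_aff_dim[OF A'(3) X X Xmono] face_eqI_aff_dim[OF B'(3) Y Y Ymono] da db j by simp_all
      then have "f ! j = f ! Suc j" using fXY j by simp
      then show False using face(2)[of j] face(2)[of "Suc j"] j by simp
    qed
    have sum: "a j + b j = j" if "j \<le> p + q" for j
      using squeezed_strict_chain[of "p + q" "\<lambda>j. a j + b j" j] strict ap[of "p + q"] bq[of "p + q"] that by simp
    have top: "a (p + q) = p" "b (p + q) = q" using sum[of "p + q"] ap[of "p + q"] bq[of "p + q"] by auto
    have a0: "a 0 = 0" "b 0 = 0" using sum[of 0] by auto
    have aS: "a (Suc j) \<le> Suc (a j)" and bS: "b (Suc j) \<le> Suc (b j)" if "j < p + q" for j
      using sum[of j] sum[of "Suc j"] amono[of j "Suc j"] bmono[of j "Suc j"] that by auto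
    have "\<exists>g\<in>flags A. \<forall>j\<le>p + q. X j = g ! a j"
      by (rule chain_compression[OF A'(3)]) (use A'(5) X Xmono da a0 top aS in \<open>auto simp: p_def\<close>)
    then obtain g where g: "g \<in> flags A" "\<And>j. j \<le> p + q \<Longrightarrow> X j = g ! a j" by blast
    have "\<exists>h\<in>flags B. \<forall>j\<le>p + q. Y j = h ! b j"
      by (rule chain_compression[OF B'(3)]) (use B'(5) Y Ymono db a0 top bS in \<open>auto simp: q_def\<close>)
    then obtain h where h: "h \<in> flags B" "\<And>j. j \<le> p + q \<Longrightarrow> Y j = h ! b j" by blast
    \<comment> \<open>the steps at which the first factor grows\<close>
    define T where "T = {j. j < p + q \<and> a (Suc j) \<noteq> a j}"
    have st: "steps T j = a j" if "j \<le> p + q" for j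
      using that
    proof (induction j)
      case (Suc j)
      then show ?case using aS[of j] amono[of j "Suc j"] by (auto simp: steps_Suc T_def)
    qed (simp add: a0)
    have Tsub: "T \<subseteq> {..<p + q}" by (auto simp: T_def)
    then have "card T = steps T (p + q)" by (simp add: steps_def Int_absorb2)
    then have "card T = p" using st top by simp
    then have "(g, h, T) \<in> W" using g h Tsub by (simp add: W_def)
    moreover have "f = dec (g, h, T)"
    proof (rule nth_equalityI)
      show "length f = length (dec (g, h, T))" by (simp add: dec_def len)
      fix j assume "j < length f"
      then have j: "j \<le> p + q" using len by simp
      have "b j = j - steps T j" using sum[OF j] st[OF j] by simp
      then show "f ! j = dec (g, h, T) ! j"
        using fXY[OF j] g(2)[OF j] h(2)[OF j] st[OF j] j by (simp add: dec_def del: upt_Suc)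
    qed
    ultimately show "f \<in> dec ` W" by blast
  qed
  moreover have finW: "finite W"
    using finite_interval_flags[OF A'(1)] finite_interval_flags[OF B'(1)]
    by (simp add: W_def flags_eq_interval_flags)
  ultimately have "card (flags (coord_sum A B)) \<le> card (dec ` W)" by (intro card_mono) auto
  also have "\<dots> \<le> card W" using finW by (rule card_image_le)
  finally show ?thesis
    by (simp add: W_def card_cartesian_product n_subsets mult_ac p_def q_def)
qed

section \<open>Flags of polar bodies\<close>

text \<open>The polar body is cut out by the finitely many inequalities that belong to the points spanning \<open>K\<close>. A ball
of radius \<open>r\<close> inside \<open>K\<close> bounds it by \<open>1 / r\<close>, and a bound \<open>M\<close> for \<open>K\<close> puts a ball of radius \<open>1 / M\<close> into it.\<close>
lemma solid_in_polar_in: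
  assumes K: "solid_in I K"
  shows "solid_in I (polar_in I K)"
proof -
  obtain r where r: "r > 0" "\<And>x. x \<in> coord_subspace I \<Longrightarrow> norm x \<le> r \<Longrightarrow> x \<in> K"
    using K unfolding solid_in_def by blast
  obtain V where V: "finite V" "K = convex hull V"
    using solid_inD(1)[OF K] unfolding polytope_def by auto
  have VK: "V \<subseteq> K" using V(2) hull_subset[of V convex] by simp
  have "polar_in I K = coord_subspace I \<inter> \<Inter>((\<lambda>v. {y. v \<bullet> y \<le> 1}) ` V)"
  proof (intro equalityI subsetI)
    fix y assume "y \<in> polar_in I K"
    then show "y \<in> coord_subspace I \<inter> \<Inter>((\<lambda>v. {y. v \<bullet> y \<le> 1}) ` V)"
      using VK unfolding polar_in_def by blast
  next
    fix y assume y: "y \<in> coord_subspace I \<inter> \<Inter>((\<lambda>v. {y. v \<bullet> y \<le> 1}) ` V)"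
    then have "V \<subseteq> {x. y \<bullet> x \<le> 1}" by (auto simp: inner_commute)
    then have "K \<subseteq> {x. y \<bullet> x \<le> 1}"
      unfolding V(2) by (rule hull_minimal) (rule convex_halfspace_le)
    then show "y \<in> polar_in I K" using y unfolding polar_in_def by (auto simp: inner_commute)
  qed
  moreover have "polyhedron (coord_subspace I)"
    by (rule affine_imp_polyhedron[OF subspace_imp_affine[OF subspace_coord_subspace]])
  moreover have "polyhedron (\<Inter>((\<lambda>v. {y. v \<bullet> y \<le> 1}) ` V))"
    using V(1) by (intro polyhedron_Inter) (auto simp: polyhedron_halfspace_le)
  ultimately have ph: "polyhedron (polar_in I K)" by simp
  have "norm y \<le> 1 / r" if y: "y \<in> polar_in I K" for y
  proof (cases "y = 0")
    case False
    have "(r / norm y) *\<^sub>R y \<in> K"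
    proof (rule r(2))
      show "(r / norm y) *\<^sub>R y \<in> coord_subspace I"
        using y by (simp add: polar_in_def subspace_mul[OF subspace_coord_subspace])
      show "norm ((r / norm y) *\<^sub>R y) \<le> r" using False r(1) by simp
    qed
    then have "((r / norm y) *\<^sub>R y) \<bullet> y \<le> 1" using y unfolding polar_in_def by blast
    moreover have "((r / norm y) *\<^sub>R y) \<bullet> y = r * norm y"
      using False by (simp add: dot_square_norm power2_eq_square)
    ultimately have "r * norm y \<le> 1" by simp
    then show ?thesis using r(1) by (simp add: field_simps)
  qed (use r(1) in simp)
  then have "bounded (polar_in I K)" by (rule boundedI)
  then have "polytope (polar_in I K)" using ph polytope_eq_bounded_polyhedron by blast
  moreover obtain M where M: "M > 0" "\<And>x. x \<in> K \<Longrightarrow> norm x \<le> M"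
    using polytope_imp_bounded[OF solid_inD(1)[OF K]] unfolding bounded_pos by blast
  have "y \<in> polar_in I K" if y: "y \<in> coord_subspace I" "norm y \<le> 1 / M" for y
  proof -
    have "x \<bullet> y \<le> 1" if x: "x \<in> K" for x
    proof -
      have "x \<bullet> y \<le> norm x * norm y" by (rule norm_cauchy_schwarz)
      also have "\<dots> \<le> M * (1 / M)" using M x y by (intro mult_mono) auto
      finally show ?thesis using M(1) by simp
    qed
    then show ?thesis using y by (simp add: polar_in_def)
  qed
  moreover have "polar_in I K \<subseteq> coord_subspace I" by (auto simp: polar_in_def)
  ultimately show ?thesis
    unfolding solid_in_def using M(1) by (intro conjI exI[of _ "1 / M"]) auto
qed

text \<open>A hyperplane that separates a point from \<open>K\<close> does not pass through \<open>0 \<in> K\<close>. So its normal vector, projected to the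
coordinate subspace, can be rescaled to a point of the polar body that excludes the given point.\<close>
lemma bipolar_in:
  assumes K: "solid_in I K"
  shows "polar_in I (polar_in I K) = K"
proof (intro equalityI subsetI)
  note K' = solid_inD[OF K]
  show "x \<in> polar_in I (polar_in I K)" if "x \<in> K" for x
    using that K'(2) by (auto simp: polar_in_def inner_commute)
  fix z assume z: "z \<in> polar_in I (polar_in I K)"
  show "z \<in> K"
  proof (rule ccontr)
    assume "z \<notin> K"
    then obtain a b where ab: "a \<bullet> z < b" "\<And>x. x \<in> K \<Longrightarrow> b < a \<bullet> x"
      using separating_hyperplane_closed_point[OF K'(3) polytope_imp_closed[OF K'(1)]] by blast
    have b: "b < 0" using ab(2)[OF K'(4)] by simp
    define y where "y = zero_coords (- I) ((1 / b) *\<^sub>R a)"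
    have xy: "x \<bullet> y = (a \<bullet> x) / b" if "x \<in> coord_subspace I" for x
      using inner_zero_coords[OF that] by (simp add: y_def inner_commute)
    have "y \<in> polar_in I K"
      unfolding polar_in_def mem_Collect_eq
    proof (intro conjI ballI)
      show "y \<in> coord_subspace I" unfolding y_def by (rule zero_coords_in_coord_subspace)
      fix x assume x: "x \<in> K"
      then have "x \<bullet> y = (a \<bullet> x) / b" using xy K'(2) by blast
      then show "x \<bullet> y \<le> 1" using ab(2)[OF x] b by (simp add: divide_le_eq)
    qed
    moreover have "z \<in> coord_subspace I" using z by (simp add: polar_in_def)
    ultimately have "(a \<bullet> z) / b \<le> 1" using z xy[of z] by (auto simp: polar_in_def inner_commute)
    then show False using ab(1) b by (simp add: divide_le_eq)
  qed
qed

definition polar_face :: "'n::finite set \<Rightarrow> (real ^ 'n) set \<Rightarrow> (real ^ 'n) set \<Rightarrow> (real ^ 'n) set" where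
  "polar_face I K F = {y \<in> polar_in I K. \<forall>x\<in>F. x \<bullet> y = 1}"

lemma polar_face_face_of:
  assumes K: "solid_in I K" and F: "F \<subseteq> K"
  shows "polar_face I K F face_of polar_in I K"
proof (cases "F = {}")
  case True
  then show ?thesis using solid_inD(3)[OF solid_in_polar_in[OF K]] by (simp add: polar_face_def face_of_refl)
next
  case False
  have cR: "convex (polar_in I K)" using solid_inD(3)[OF solid_in_polar_in[OF K]] .
  have "polar_face I K F = \<Inter>((\<lambda>x. polar_in I K \<inter> {y. x \<bullet> y = 1}) ` F)"
    using False by (auto simp: polar_face_def)
  also have "\<dots> face_of polar_in I K"
  proof (rule face_of_Inter)
    show "(\<lambda>x. polar_in I K \<inter> {y. x \<bullet> y = 1}) ` F \<noteq> {}" using False by simp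
    fix T assume "T \<in> (\<lambda>x. polar_in I K \<inter> {y. x \<bullet> y = 1}) ` F"
    then obtain x where x: "x \<in> F" "T = polar_in I K \<inter> {y. x \<bullet> y = 1}" by blast
    show "T face_of polar_in I K" unfolding x(2)
      by (rule face_of_Int_supporting_hyperplane_le[OF cR]) (use x(1) F in \<open>auto simp: polar_in_def\<close>)
  qed
  finally show ?thesis .
qed

text \<open>A face other than \<open>{}\<close> and \<open>K\<close> is exposed by a hyperplane which misses \<open>0\<close>, as \<open>0\<close> is an interior point
relative to the coordinate subspace. Its normal vector, projected to that subspace and rescaled, is a point of the polar face that recovers the given face.\<close>
lemma polar_face_determines_face:
  assumes K: "solid_in I K" and F: "F face_of K"
  shows "F = {x \<in> K. \<forall>y\<in>polar_face I K F. x \<bullet> y = 1}"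
proof
  note K' = solid_inD[OF K]
  have FK: "F \<subseteq> K" using F face_of_imp_subset by blast
  then show "F \<subseteq> {x \<in> K. \<forall>y\<in>polar_face I K F. x \<bullet> y = 1}" by (auto simp: polar_face_def)
  show "{x \<in> K. \<forall>y\<in>polar_face I K F. x \<bullet> y = 1} \<subseteq> F"
  proof (cases "F = {} \<or> F = K")
    case True
    have "0 \<in> polar_face I K {}" using solid_inD(4)[OF solid_in_polar_in[OF K]] by (simp add: polar_face_def)
    then show ?thesis using True by auto
  next
    case False
    have "F exposed_face_of K"
      using exposed_face_of_polyhedron polytope_imp_polyhedron K'(1) F by blast
    then obtain a b where ab: "K \<subseteq> {x. a \<bullet> x \<le> b}" "F = K \<inter> {x. a \<bullet> x = b}"
      unfolding exposed_face_of_def by blast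
    have "b \<ge> 0" using ab(1) K'(4) by force
    moreover have "b \<noteq> 0"
    proof
      assume b0: "b = 0"
      have "a \<bullet> z = b" if z: "z \<in> K" for z
      proof -
        obtain t where t: "t > 0" "t *\<^sub>R z \<in> K" "- (t *\<^sub>R z) \<in> K"
          using solid_in_absorbs[OF K] K'(2) z by blast
        have "a \<bullet> (t *\<^sub>R z) \<le> 0" "a \<bullet> (- (t *\<^sub>R z)) \<le> 0" using ab(1) b0 t by auto
        then have "t * (a \<bullet> z) = 0" by simp
        then show ?thesis using t(1) b0 by simp
      qed
      then show False using False ab(2) by auto
    qed
    ultimately have b: "b > 0" by simp
    define y where "y = zero_coords (- I) ((1 / b) *\<^sub>R a)"
    have xy: "x \<bullet> y = (a \<bullet> x) / b" if "x \<in> K" for x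
      using inner_zero_coords[of x I] that K'(2) by (auto simp: y_def inner_commute)
    have "y \<in> polar_in I K"
      unfolding polar_in_def mem_Collect_eq
    proof (intro conjI ballI)
      show "y \<in> coord_subspace I" unfolding y_def by (rule zero_coords_in_coord_subspace)
      show "x \<bullet> y \<le> 1" if "x \<in> K" for x
        using xy[OF that] ab(1) that b by (auto simp: divide_le_eq)
    qed
    then have y: "y \<in> polar_face I K F"
      using ab(2) b xy by (auto simp: polar_face_def)
    show ?thesis
    proof
      fix x assume x: "x \<in> {x \<in> K. \<forall>y\<in>polar_face I K F. x \<bullet> y = 1}"
      then have "(a \<bullet> x) / b = 1" using y xy by auto
      then show "x \<in> F" using x ab(2) b by simp
    qed
  qed
qed

text \<open>Taking polar faces turns the chain \<open>{}\<close>, \<open>f ! 0\<close>, \<dots>, \<open>f ! (n - 1)\<close> of proper faces of \<open>K\<close> into a strictly decreasing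
chain of nonempty faces of the polar body that starts with the polar body itself. Read backwards, it is
a flag; the last entry \<open>f ! n = K\<close> is left out because its polar face is empty.\<close>
lemma card_flags_le_polar_in:
  assumes K: "solid_in I K"
  shows "card (flags K) \<le> card (flags (polar_in I K))"
proof -
  define n where "n = card I"
  note K' = solid_inD[OF K] and R' = solid_inD[OF solid_in_polar_in[OF K]]
  let ?R = "polar_in I K" and ?D = "polar_face I K"
  have inj: "F = G" if "F face_of K" "G face_of K" "?D F = ?D G" for F G
    using polar_face_determines_face[OF K that(1)] polar_face_determines_face[OF K that(2)] that(3) by simp
  define \<Psi> where "\<Psi> f = map (\<lambda>k. ?D (({} # f) ! (n - k))) [0..<Suc n]" for f
  have len: "length f = Suc n" if "f \<in> flags K" for f
    using that K'(5) by (auto simp: flags_def n_def)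
  have face: "({} # f) ! j face_of K" and dim: "aff_dim (({} # f) ! j) = int j - 1"
    if "f \<in> flags K" "j \<le> Suc n" for f j
    using that len[OF that(1)] by (cases j; simp add: flags_def)+
  have sub: "({} # f) ! j \<subseteq> ({} # f) ! Suc j" if "f \<in> flags K" "j \<le> n" for f j
    using that len[OF that(1)] by (cases j) (simp_all add: flags_def)
  have nth: "\<Psi> f ! k = ?D (({} # f) ! (n - k))" if "k \<le> n" for f k
    using that by (simp add: \<Psi>_def del: upt_Suc)
  have flag: "\<Psi> f \<in> flags ?R" if f: "f \<in> flags K" for f
  proof -
    note sub = sub[OF f] and face = face[OF f] and dim = dim[OF f]
    define E where "E k = ?D (({} # f) ! (n - k))" for k
    have strictD: "?D (({} # f) ! Suc j) \<subset> ?D (({} # f) ! j)" if "j \<le> n" for j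
    proof -
      have "?D (({} # f) ! Suc j) \<subseteq> ?D (({} # f) ! j)" using sub[OF that] by (auto simp: polar_face_def)
      moreover have "({} # f) ! Suc j \<noteq> ({} # f) ! j" using dim[of j] dim[of "Suc j"] that by auto
      ultimately show ?thesis using inj face that by (metis Suc_le_mono le_SucI psubsetI)
    qed
    have E: "E k face_of ?R" if "k \<le> n" for k
      unfolding E_def using polar_face_face_of[OF K face_of_imp_subset[OF face]] that by simp
    have Esub: "E k \<subset> E (Suc k)" if "k < n" for k
      unfolding E_def using strictD[of "n - Suc k"] that by (simp add: Suc_diff_Suc)
    have Ene: "E k \<noteq> {}" if "k \<le> n" for k
      unfolding E_def using strictD[of "n - k"] by auto
    define s where "s k = nat (aff_dim (E k))" for k
    have s: "aff_dim (E k) = int (s k)" if "k \<le> n" for k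
      using Ene[OF that] by (simp add: s_def aff_dim_nonneg)
    have "s k < s (Suc k)" if k: "k < n" for k
    proof -
      have "aff_dim (E k) < aff_dim (E (Suc k))"
        using face_eqI_aff_dim[OF R'(3) E E, of k "Suc k"] Esub[OF k] k by fastforce
      then show ?thesis using s k by simp
    qed
    moreover have "s n \<le> n"
      using aff_dim_subset[OF face_of_imp_subset[OF E[OF order_refl]]] s[OF order_refl] R'(5) by (simp add: n_def)
    ultimately have sk: "s k = k" if "k \<le> n" for k using squeezed_strict_chain[of n s k] that by blast
    have lenP: "length (\<Psi> f) = Suc n" by (simp add: \<Psi>_def)
    show ?thesis
      unfolding flags_def mem_Collect_eq lenP
    proof (intro conjI allI impI)
      show "int (Suc n) = aff_dim ?R + 1" using R'(5) by (simp add: n_def)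
      fix k assume k: "k < Suc n"
      show "\<Psi> f ! k face_of ?R" "aff_dim (\<Psi> f ! k) = int k"
        using E[of k] s[of k] sk[of k] nth[of k f] k by (simp_all add: E_def)
    next
      fix k assume k: "Suc k < Suc n"
      show "\<Psi> f ! k \<subseteq> \<Psi> f ! Suc k"
        using Esub[of k] nth[of k f] nth[of "Suc k" f] k by (auto simp: E_def)
    qed
  qed
  have "inj_on \<Psi> (flags K)"
  proof (rule inj_onI)
    fix f g assume f: "f \<in> flags K" and g: "g \<in> flags K" and eq: "\<Psi> f = \<Psi> g"
    have low: "({} # f) ! j = ({} # g) ! j" if "j \<le> n" for j
    proof (rule inj)
      show "({} # f) ! j face_of K" "({} # g) ! j face_of K" using face f g that by auto
      show "?D (({} # f) ! j) = ?D (({} # g) ! j)"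
        using nth[of "n - j" f] nth[of "n - j" g] that eq by simp
    qed
    show "f = g"
    proof (rule nth_equalityI)
      show "length f = length g" using len f g by simp
      fix j assume "j < length f"
      then consider "Suc j \<le> n" | "j = n" using len[OF f] by linarith
      then show "f ! j = g ! j"
      proof cases
        case 1
        then show ?thesis using low[of "Suc j"] by simp
      next
        case 2
        then show ?thesis
          using interval_flags_last[OF K'(3)] f g len flags_eq_interval_flags by metis
      qed
    qed
  qed
  moreover have "\<Psi> ` flags K \<subseteq> flags ?R" using flag by blast
  moreover have "finite (flags ?R)"
    using finite_interval_flags[OF R'(1)] by (simp add: flags_eq_interval_flags)
  ultimately show ?thesis by (rule card_inj_on_le)
qed

section \<open>Hanner polytopes\<close>

lemma axis_segment_eq:
  assumes "a > 0"
  shows "closed_segment (axis i (- a)) (axis i a) = {x \<in> coord_subspace {i}. \<bar>x $ i\<bar> \<le> a}"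
proof (intro equalityI subsetI)
  fix x assume "x \<in> closed_segment (axis i (- a)) (axis i a)"
  then obtain u where u: "0 \<le> u" "u \<le> 1" "x = (1 - u) *\<^sub>R axis i (- a) + u *\<^sub>R axis i a"
    by (auto simp: closed_segment_def)
  have "x $ i = (2 * u - 1) * a" unfolding u(3) by (simp add: axis_def algebra_simps)
  moreover have "\<bar>2 * u - 1\<bar> * a \<le> 1 * a" using u assms by (intro mult_right_mono) auto
  ultimately have "\<bar>x $ i\<bar> \<le> a" using assms by (simp add: abs_mult)
  moreover have "x \<in> coord_subspace {i}" using u(3) by (auto simp: coord_subspace_def axis_def)
  ultimately show "x \<in> {x \<in> coord_subspace {i}. \<bar>x $ i\<bar> \<le> a}" by simp
next
  fix x assume x: "x \<in> {x \<in> coord_subspace {i}. \<bar>x $ i\<bar> \<le> a}"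
  define u where "u = (x $ i + a) / (2 * a)"
  have "0 \<le> u" "u \<le> 1" using x assms by (auto simp: u_def field_simps)
  moreover have "x = (1 - u) *\<^sub>R axis i (- a) + u *\<^sub>R axis i a"
    using x assms by (auto simp: vec_eq_iff axis_def coord_subspace_def u_def field_simps)
  ultimately show "x \<in> closed_segment (axis i (- a)) (axis i a)"
    unfolding closed_segment_def by blast
qed

lemma solid_in_axis_segment:
  assumes "a > 0"
  shows "solid_in {i} (closed_segment (axis i (- a)) (axis i a))"
  unfolding solid_in_def
proof (intro conjI exI[of _ a] ballI impI)
  show "polytope (closed_segment (axis i (- a)) (axis i a))"
    unfolding segment_convex_hull by (rule polytope_convex_hull) simp
  show "x \<in> closed_segment (axis i (- a)) (axis i a)"
    if "x \<in> coord_subspace {i}" "norm x \<le> a" for x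
    using that component_le_norm_cart[of x i] by (simp add: axis_segment_eq[OF assms])
qed (use assms in \<open>auto simp: axis_segment_eq\<close>)

lemma card_flags_segment_le:
  assumes "u \<noteq> v"
  shows "card (flags (closed_segment u v)) \<le> 2"
proof -
  have "flags (closed_segment u v) \<subseteq> {[{u}, closed_segment u v], [{v}, closed_segment u v]}"
  proof
    fix f assume f: "f \<in> flags (closed_segment u v)"
    have "aff_dim (closed_segment u v) = 1"
      using assms by (simp add: segment_convex_hull aff_dim_convex_hull)
    then have len: "length f = 2" using f by (simp add: flags_def)
    have "f ! 0 face_of closed_segment u v" "aff_dim (f ! 0) = 0" using f len by (auto simp: flags_def)
    moreover then obtain w where "f ! 0 = {w}" by (auto simp: aff_dim_eq_0)
    ultimately have "w \<in> {u, v}" "f ! 0 = {w}"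
      by (auto simp: face_of_singleton extreme_point_of_segment)
    moreover have "f ! 1 = closed_segment u v"
      using interval_flags_last[of "closed_segment u v" f "{}" 1] f len by (simp add: flags_eq_interval_flags)
    moreover have "f = [f ! 0, f ! 1]" using len by (auto simp: list_eq_iff_nth_eq less_2_cases_iff nth_Cons')
    ultimately show "f \<in> {[{u}, closed_segment u v], [{v}, closed_segment u v]}" by auto
  qed
  then have "card (flags (closed_segment u v)) \<le> card {[{u}, closed_segment u v], [{v}, closed_segment u v]}"
    by (intro card_mono) auto
  also have "\<dots> \<le> 2" by (simp add: card_insert_if)
  finally show ?thesis .
qed

lemma unconditionalI:
  assumes "\<And>i x. x \<in> K \<Longrightarrow> coord_reflection i x \<in> K"
  shows "unconditional K"
  unfolding unconditional_def
proof (intro allI set_eqI)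
  fix i x show "x \<in> coord_reflection i ` K \<longleftrightarrow> x \<in> K"
    using assms[of x i] assms[of "coord_reflection i x" i] by (auto simp: mem_coord_reflection_image)
qed

lemma unconditionalD: "unconditional K \<Longrightarrow> x \<in> K \<Longrightarrow> coord_reflection i x \<in> K"
  unfolding unconditional_def by blast

lemma inner_coord_reflection: "x \<bullet> coord_reflection i y = coord_reflection i x \<bullet> y"
  unfolding inner_vec_def by (rule sum.cong) auto

lemma hanner_on_bounds:
  assumes "hanner_on I H"
  shows "solid_in I H \<and> unconditional H \<and> card (flags H) \<le> 2 ^ card I * fact (card I)"
  using assms
proof (induction rule: hanner_on.induct)
  case (segment a i)
  have "unconditional (closed_segment (axis i (- a)) (axis i a))"
    by (rule unconditionalI) (auto simp: axis_segment_eq[OF segment] coord_subspace_def)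
  moreover have "axis i (- a) \<noteq> axis i a" using segment by (simp add: axis_eq_axis)
  then have "card (flags (closed_segment (axis i (- a)) (axis i a))) \<le> 2" by (rule card_flags_segment_le)
  ultimately show ?case by (simp add: solid_in_axis_segment[OF segment])
next
  case (product I A J B)
  then have A: "solid_in I A" and B: "solid_in J B" and uA: "unconditional A" and uB: "unconditional B" by auto
  let ?p = "card I" and ?q = "card J"
  have K: "{x + y | x y. x \<in> A \<and> y \<in> B} = coord_sum A B" by (simp add: coord_sum_def)
  have "unconditional (coord_sum A B)"
  proof (rule unconditionalI)
    fix i z assume "z \<in> coord_sum A B"
    then obtain x y where z: "z = x + y" "x \<in> A" "y \<in> B" by (auto simp: coord_sum_def)
    then have "coord_reflection i z = coord_reflection i x + coord_reflection i y"
      by (simp add: linear_add[OF linear_coord_reflection])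
    then show "coord_reflection i z \<in> coord_sum A B"
      using unconditionalD[OF uA z(2)] unconditionalD[OF uB z(3)] unfolding coord_sum_def by blast
  qed
  moreover have "card (flags (coord_sum A B)) \<le> 2 ^ card (I \<union> J) * fact (card (I \<union> J))"
  proof -
    have "card (flags (coord_sum A B)) \<le> ((?p + ?q) choose ?p) * (card (flags A) * card (flags B))"
      by (rule card_flags_coord_sum_le[OF A B product.hyps(3)])
    also have "\<dots> \<le> ((?p + ?q) choose ?p) * ((2 ^ ?p * fact ?p) * (2 ^ ?q * fact ?q))"
      using product.IH by (intro mult_le_mono) auto
    also have "\<dots> = 2 ^ (?p + ?q) * fact (?p + ?q)"
      using binomial_fact_lemma[of ?p "?p + ?q"] by (simp add: power_add algebra_simps)
    also have "?p + ?q = card (I \<union> J)" using product.hyps(3) by (simp add: card_Un_disjoint)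
    finally show ?thesis .
  qed
  ultimately show ?case using solid_in_coord_sum[OF A B product.hyps(3)] unfolding K by blast
next
  case (polar I A)
  then have A: "solid_in I A" and uA: "unconditional A" by auto
  have "unconditional (polar_in I A)"
  proof (rule unconditionalI)
    fix i y assume "y \<in> polar_in I A"
    then show "coord_reflection i y \<in> polar_in I A"
      using unconditionalD[OF uA] by (auto simp: polar_in_def coord_subspace_def inner_coord_reflection)
  qed
  moreover have "card (flags (polar_in I A)) \<le> card (flags A)"
    using card_flags_le_polar_in[OF solid_in_polar_in[OF A]] bipolar_in[OF A] by simp
  ultimately show ?case using solid_in_polar_in[OF A] polar.IH by auto
qed

theorem corollary1p4:
  fixes P H :: "(real ^ 'n::finite) set"
  assumes "polytope P" and "aff_dim P = int CARD('n)" and "unconditional P"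
    and "hanner_polytope H" and "aff_dim H = aff_dim P"
  shows "card (flags P) \<ge> card (flags H) \<and> card (flags H) = 2 ^ CARD('n) * fact CARD('n)"
proof -
  obtain I where "hanner_on I H" using assms(4) unfolding hanner_polytope_def by blast
  then have H: "solid_in I H" "unconditional H" "card (flags H) \<le> 2 ^ card I * fact (card I)"
    using hanner_on_bounds by auto
  have "card I = CARD('n)" using solid_inD(5)[OF H(1)] assms(2,5) by simp
  then have "card (flags H) \<le> 2 ^ CARD('n) * fact CARD('n)" using H(3) by simp
  moreover have "2 ^ CARD('n) * fact CARD('n) \<le> card (flags H)"
    using card_flags_unconditional_ge[OF solid_inD(1)[OF H(1)] _ H(2)] assms(2,5) by simp
  moreover have "2 ^ CARD('n) * fact CARD('n) \<le> card (flags P)"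
    by (rule card_flags_unconditional_ge[OF assms(1-3)])
  ultimately show ?thesis by simp
qed

end
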